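(* Let $(T,v)$ be an unbounded rooted tree, and let $(T_\infty,v)\subseteq (T,v)$ be its maximal geodesically complete subtree. Then $h(T)>0$ if and only if $(T_\infty,v)$ is pseudo-regular and $(T,v)$ is complemented. Furthermore, if $(T_\infty,v)$ is $K$-pseudo-regular and $(T,v)$ is $C$-complemented, with $K,C\ge 1$, then $$h(T_\infty)\ \ge\ h(T)\ \ge\ \frac{h(T_\infty)}{C+(C-1)h(T_\infty)}\ \ge\ \frac{1}{(7K+1)C-1}.$$
   Context: A tree is a connected graph without cycles (not assumed locally finite), viewed as a metric space with the length metric $d$ in which every edge has length $1$; a rooted tree $(T,v)$ is a tree $T$ with a fixed vertex $v$ (the root). $T$ is unbounded if $\operatorname{diam} T=\infty$. For a graph $\Gamma$ with vertex set $V(\Gamma)$, the Cheeger constant is $h(\Gamma)=\inf_A |\partial A|/|A|$, where $A$ ranges over all non-empty finite subsets of $V(\Gamma)$ and $\partial A$ is the set of vertices at distance exactly $1$ from $A$. $(T,v)$ is geodesically complete if every isometric embedding $f:[0,t]\to T$ with $t>0$ and $f(0)=v$ extends to an isometric embedding $F:[0,\infty)\to T$. Every rooted tree $(T,v)$ contains a unique geodesically complete subtree $(T_\infty,v)$ that is maximal under inclusion (known fact). A point $v$ of a geodesic space $X$ is a pole if there is $M>0$ such that each point of $X$ lies in the $M$-neighborhood of some geodesic ray emanating from $v$. For $k\in\mathbb N=\{0,1,2,\dots\}$ let $S(v,k)=\{w\in V(T): d(v,w)=k\}$, and for $x\in T$ let $T^v_x=\{y\in T: x\in[vy]\}$, where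 $[vy]$ is the geodesic from $v$ to $y$. Given a tree $T$ with a pole $v$ and a natural number $K$, $(T,v)$ is $K$-pseudo-regular if for every $t\in\mathbb N$ and every $a\in S(v,t)$ there are at least two distinct points in $S(v,t+K)\cap T^v_a$; it is pseudo-regular if it is $K$-pseudo-regular for some $K$. For $C\in\mathbb N$, $(T,v)$ is $C$-complemented if $|V(T_0)|\le C$ for every connected component $T_0$ of the closure of $T\setminus T_\infty$; it is complemented if it is $C$-complemented for some $C\in\mathbb N$. *)

theory Defs
  imports "HOL-Analysis.Analysis"
begin

section \<open>Graphs and trees\<close>

record 'a ugraph =
  verts :: "'a set"
  edges :: "'a set set"

definition simple_graph :: "'a ugraph \<Rightarrow> bool" where
  "simple_graph G \<longleftrightarrow> (\<forall>e\<in>edges G. e \<subseteq> verts G \<and> card e = 2)"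

definition adj :: "'a ugraph \<Rightarrow> 'a \<Rightarrow> 'a \<Rightarrow> bool" where
  "adj G u w \<longleftrightarrow> {u, w} \<in> edges G"

definition connected_graph :: "'a ugraph \<Rightarrow> bool" where
  "connected_graph G \<longleftrightarrow> simple_graph G \<and> (\<forall>u\<in>verts G. \<forall>w\<in>verts G. (adj G)\<^sup>*\<^sup>* u w)"

definition is_cycle :: "'a ugraph \<Rightarrow> 'a list \<Rightarrow> bool" where
  "is_cycle G us \<longleftrightarrow>
     3 \<le> length us \<and> distinct us \<and> successively (adj G) us \<and> adj G (last us) (hd us)"

definition tree :: "'a ugraph \<Rightarrow> bool" where
  "tree G \<longleftrightarrow> connected_graph G \<and> \<not> (\<exists>us. is_cycle G us)"

definition rooted_tree :: "'a ugraph \<Rightarrow> 'a \<Rightarrow> bool" where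
  "rooted_tree G v \<longleftrightarrow> tree G \<and> v \<in> verts G"

definition subgraph_of :: "'a ugraph \<Rightarrow> 'a ugraph \<Rightarrow> bool" where
  "subgraph_of H G \<longleftrightarrow> verts H \<subseteq> verts G \<and> edges H \<subseteq> edges G"


section \<open>The metric graph\<close>

text \<open>
  Points of the geometric realization are given by barycentric coordinates: the point at
  distance \<open>s\<close> from \<open>u\<close> on the edge \<open>{u, w}\<close> is the function with value \<open>1 - s\<close> at \<open>u\<close>,
  value \<open>s\<close> at \<open>w\<close>, and \<open>0\<close> elsewhere. In particular the realization of a subgraph is
  literally a subset of the realization of the graph.
\<close>

definition vpt :: "'a \<Rightarrow> 'a \<Rightarrow> real" where
  "vpt u = (\<lambda>x. if x = u then 1 else 0)"

definition closed_edge :: "'a set \<Rightarrow> ('a \<Rightarrow> real) set" where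
  "closed_edge e = {p. (\<forall>x. 0 \<le> p x) \<and> (\<forall>x. x \<notin> e \<longrightarrow> p x = 0) \<and> (\<Sum>x\<in>e. p x) = 1}"

definition realization :: "'a ugraph \<Rightarrow> ('a \<Rightarrow> real) set" where
  "realization G = vpt ` verts G \<union> (\<Union>e\<in>edges G. closed_edge e)"

text \<open>
  On \<open>e = {u, w}\<close> both summands equal the difference of the two arc length parameters, hence
  the factor \<open>1 / 2\<close> (every edge has length 1).
\<close>

definition edge_length :: "'a set \<Rightarrow> ('a \<Rightarrow> real) \<Rightarrow> ('a \<Rightarrow> real) \<Rightarrow> real" where
  "edge_length e p q = (\<Sum>x\<in>e. \<bar>p x - q x\<bar>) / 2"

text \<open>
  \<open>pl_path G l p q\<close>: there is a piecewise linear path of length \<open>l\<close> from \<open>p\<close> to \<open>q\<close>, that is, a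
  finite concatenation of linear segments each of which runs inside one edge.
\<close>

inductive pl_path :: "'a ugraph \<Rightarrow> real \<Rightarrow> ('a \<Rightarrow> real) \<Rightarrow> ('a \<Rightarrow> real) \<Rightarrow> bool" for G where
  pl_refl: "p \<in> realization G \<Longrightarrow> pl_path G 0 p p"
| pl_step: "e \<in> edges G \<Longrightarrow> p \<in> closed_edge e \<Longrightarrow> q \<in> closed_edge e \<Longrightarrow> pl_path G l q r
     \<Longrightarrow> pl_path G (edge_length e p q + l) p r"

text \<open>
  The length metric of a connected graph, see \<open>Metric_space_gdist\<close> below. The second case only
  concerns arguments that are not joined by a path, hence not pairs of points of a connected graph;
  \<^const>\<open>Metric_space\<close> wants nonnegativity there, too.
\<close>

definition gdist :: "'a ugraph \<Rightarrow> ('a \<Rightarrow> real) \<Rightarrow> ('a \<Rightarrow> real) \<Rightarrow> real" where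
  "gdist G p q = (if \<exists>l. pl_path G l p q then Inf {l. pl_path G l p q} else 0)"

definition gtop :: "'a ugraph \<Rightarrow> ('a \<Rightarrow> real) topology" where
  "gtop G = Metric_space.mtopology (realization G) (gdist G)"

definition diam :: "'a ugraph \<Rightarrow> ereal" where
  "diam G = (SUP p\<in>realization G. SUP q\<in>realization G. ereal (gdist G p q))"


section \<open>Cheeger constant\<close>

definition vertex_boundary :: "'a ugraph \<Rightarrow> 'a set \<Rightarrow> 'a set" where
  "vertex_boundary G A = {w \<in> verts G. (INF a\<in>A. gdist G (vpt w) (vpt a)) = 1}"

text \<open>
  Graphs need not be locally finite, so boundaries of finite sets may be infinite and the Cheeger
  constant takes values in \<open>[0, \<infinity>]\<close>.
\<close>

definition ecard :: "'b set \<Rightarrow> ennreal" where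
  "ecard A = (if finite A then of_nat (card A) else \<infinity>)"

definition cheeger :: "'a ugraph \<Rightarrow> ennreal" where
  "cheeger G = (INF A\<in>{A. A \<noteq> {} \<and> finite A \<and> A \<subseteq> verts G}. ecard (vertex_boundary G A) / ecard A)"

text \<open>
  The function \<open>h / (C + (C - 1) h)\<close> of \<open>h \<in> [0, \<infinity>]\<close>, where the value at \<open>h = \<infinity>\<close> is the limit
  \<open>1 / (C - 1)\<close> (which is \<open>\<infinity>\<close> if \<open>C = 1\<close>, as \<open>1 / 0 = \<infinity>\<close> in \<^typ>\<open>ennreal\<close>); the library's
  \<open>\<infinity> / \<infinity> = 0\<close> would be the wrong value there. Used for \<open>C \<ge> 1\<close> only.
\<close>

definition cheeger_lower :: "nat \<Rightarrow> ennreal \<Rightarrow> ennreal" where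
  "cheeger_lower C h =
     (if h = \<infinity> then 1 / of_nat (C - 1) else h / (of_nat C + of_nat (C - 1) * h))"


section \<open>Geodesics and geodesic completeness\<close>

definition isometric_embedding :: "real set \<Rightarrow> 'a ugraph \<Rightarrow> (real \<Rightarrow> 'a \<Rightarrow> real) \<Rightarrow> bool" where
  "isometric_embedding I G f \<longleftrightarrow>
     f ` I \<subseteq> realization G \<and> (\<forall>s\<in>I. \<forall>s'\<in>I. gdist G (f s) (f s') = \<bar>s - s'\<bar>)"

definition geodesically_complete :: "'a ugraph \<Rightarrow> 'a \<Rightarrow> bool" where
  "geodesically_complete G v \<longleftrightarrow>
     (\<forall>t>0. \<forall>f. isometric_embedding {0..t} G f \<and> f 0 = vpt v \<longrightarrow>
        (\<exists>F. isometric_embedding {0..} G F \<and> (\<forall>s\<in>{0..t}. F s = f s)))"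

definition geodesically_complete_subtree :: "'a ugraph \<Rightarrow> 'a \<Rightarrow> 'a ugraph \<Rightarrow> bool" where
  "geodesically_complete_subtree T v S \<longleftrightarrow>
     subgraph_of S T \<and> rooted_tree S v \<and> geodesically_complete S v"

definition maximal_geodesically_complete_subtree :: "'a ugraph \<Rightarrow> 'a \<Rightarrow> 'a ugraph \<Rightarrow> bool" where
  "maximal_geodesically_complete_subtree T v S \<longleftrightarrow>
     geodesically_complete_subtree T v S \<and>
     (\<forall>S'. geodesically_complete_subtree T v S' \<and> subgraph_of S S' \<longrightarrow> S' = S)"


section \<open>Pseudo-regular and complemented trees\<close>

definition pole :: "'a ugraph \<Rightarrow> 'a \<Rightarrow> bool" where
  "pole G v \<longleftrightarrow>
     (\<exists>M>0. \<forall>x\<in>realization G. \<exists>F. isometric_embedding {0..} G F \<and> F 0 = vpt v \<and>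
        (\<exists>s\<ge>0. gdist G x (F s) < M))"

definition sphere_pts :: "'a ugraph \<Rightarrow> 'a \<Rightarrow> nat \<Rightarrow> ('a \<Rightarrow> real) set" where
  "sphere_pts G v k = {p \<in> vpt ` verts G. gdist G (vpt v) p = real k}"

text \<open>Union of all geodesics from \<open>p\<close> to \<open>q\<close>; in a tree there is exactly one.\<close>

definition geodesic_segment :: "'a ugraph \<Rightarrow> ('a \<Rightarrow> real) \<Rightarrow> ('a \<Rightarrow> real) \<Rightarrow> ('a \<Rightarrow> real) set" where
  "geodesic_segment G p q =
     \<Union>{f ` {0..l} | f l. 0 \<le> l \<and> isometric_embedding {0..l} G f \<and> f 0 = p \<and> f l = q}"

definition subtree_beyond :: "'a ugraph \<Rightarrow> 'a \<Rightarrow> ('a \<Rightarrow> real) \<Rightarrow> ('a \<Rightarrow> real) set" where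
  "subtree_beyond G v x = {y \<in> realization G. x \<in> geodesic_segment G (vpt v) y}"

definition K_pseudo_regular :: "nat \<Rightarrow> 'a ugraph \<Rightarrow> 'a \<Rightarrow> bool" where
  "K_pseudo_regular K G v \<longleftrightarrow>
     pole G v \<and>
     (\<forall>t. \<forall>a\<in>sphere_pts G v t.
        \<exists>p q. p \<noteq> q \<and> {p, q} \<subseteq> sphere_pts G v (t + K) \<inter> subtree_beyond G v a)"

definition pseudo_regular :: "'a ugraph \<Rightarrow> 'a \<Rightarrow> bool" where
  "pseudo_regular G v \<longleftrightarrow> (\<exists>K. K_pseudo_regular K G v)"

text \<open>Here \<open>S\<close> stands for the maximal geodesically complete subtree of \<open>T\<close>.\<close>

definition C_complemented :: "nat \<Rightarrow> 'a ugraph \<Rightarrow> 'a ugraph \<Rightarrow> bool" where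
  "C_complemented C T S \<longleftrightarrow>
     (\<forall>T0 \<in> connected_components_of
         (subtopology (gtop T) (gtop T closure_of (realization T - realization S))).
        finite {u \<in> verts T. vpt u \<in> T0} \<and> card {u \<in> verts T. vpt u \<in> T0} \<le> C)"

definition complemented :: "'a ugraph \<Rightarrow> 'a ugraph \<Rightarrow> bool" where
  "complemented T S \<longleftrightarrow> (\<exists>C. C_complemented C T S)"


section \<open>The length metric is a metric\<close>

lemma edge_length_nonneg: "0 \<le> edge_length e p q"
  by (auto simp: edge_length_def intro: sum_nonneg)

lemma edge_length_sym: "edge_length e p q = edge_length e q p"
  by (simp add: edge_length_def abs_minus_commute)

lemma pl_path_nonneg: "pl_path G l p q \<Longrightarrow> 0 \<le> l"
  by (induction rule: pl_path.induct) (auto simp: edge_length_nonneg)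

lemma pl_path_trans:
  "pl_path G l p q \<Longrightarrow> pl_path G m q r \<Longrightarrow> pl_path G (l + m) p r"
  by (induction rule: pl_path.induct) (auto simp: add.assoc intro: pl_step)

lemma pl_path_edge:
  assumes "e \<in> edges G" "p \<in> closed_edge e" "q \<in> closed_edge e"
  shows "pl_path G (edge_length e p q) p q"
proof -
  have "q \<in> realization G" using assms by (auto simp: realization_def)
  then show ?thesis using pl_step[OF assms pl_refl] by simp
qed

lemma pl_path_sym: "pl_path G l p q \<Longrightarrow> pl_path G l q p"
proof (induction rule: pl_path.induct)
  case (pl_refl p)
  then show ?case by (rule pl_path.pl_refl)
next
  case (pl_step e p q l r)
  then have "pl_path G (l + edge_length e q p) r p"
    by (blast intro: pl_path_trans pl_path_edge)
  then show ?case by (simp add: add.commute edge_length_sym)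
qed

lemma gdist_le:
  assumes "pl_path G l p q"
  shows "gdist G p q \<le> l"
proof -
  have "Inf {l. pl_path G l p q} \<le> l"
    using assms by (intro cInf_lower bdd_belowI[of _ 0]) (auto dest: pl_path_nonneg)
  then show ?thesis using assms by (auto simp: gdist_def)
qed

lemma gdist_greatest:
  assumes "pl_path G k p q" "\<And>l. pl_path G l p q \<Longrightarrow> m \<le> l"
  shows "m \<le> gdist G p q"
proof -
  have "m \<le> Inf {l. pl_path G l p q}" using assms by (intro cInf_greatest) auto
  then show ?thesis using assms(1) by (auto simp: gdist_def)
qed

lemma gdist_nonneg: "0 \<le> gdist G p q"
proof (cases "\<exists>l. pl_path G l p q")
  case True
  then show ?thesis by (blast intro: gdist_greatest pl_path_nonneg)
qed (simp add: gdist_def)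

lemma pl_path_coord:
  assumes G: "simple_graph G"
  shows "pl_path G l p q \<Longrightarrow> \<bar>p x - q x\<bar> \<le> l"
proof (induction rule: pl_path.induct)
  case (pl_refl p)
  then show ?case by simp
next
  case (pl_step e p q l r)
  obtain u w where e: "e = {u, w}" "u \<noteq> w"
    using G pl_step.hyps(1) by (auto simp: simple_graph_def card_2_iff)
  have "p u + p w = 1" "q u + q w = 1" "x \<notin> e \<Longrightarrow> p x = 0" "x \<notin> e \<Longrightarrow> q x = 0"
    using pl_step.hyps e by (auto simp: closed_edge_def)
  then have "\<bar>p x - q x\<bar> \<le> edge_length e p q"
    using e by (cases "x \<in> e") (auto simp: edge_length_def)
  then show ?case using pl_step.IH by linarith
qed

lemma vpt_in_closed_edge: "finite e \<Longrightarrow> u \<in> e \<Longrightarrow> vpt u \<in> closed_edge e"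
  by (simp add: closed_edge_def vpt_def)

lemma pl_path_exists:
  assumes G: "connected_graph G" and p: "p \<in> realization G" and q: "q \<in> realization G"
  shows "\<exists>l. pl_path G l p q"
proof -
  have sg: "simple_graph G" using G by (simp add: connected_graph_def)
  have fin: "finite e" "e \<noteq> {}" "e \<subseteq> verts G" if "e \<in> edges G" for e
  proof -
    have "card e = 2" "e \<subseteq> verts G" using sg that by (auto simp: simple_graph_def)
    then show "finite e" "e \<noteq> {}" "e \<subseteq> verts G" by (auto intro: card_ge_0_finite)
  qed
  have near: "\<exists>u\<in>verts G. \<exists>l. pl_path G l p (vpt u)" if p: "p \<in> realization G" for p
  proof (cases "p \<in> vpt ` verts G")
    case True
    then show ?thesis using p pl_refl by blast
  next
    case False
    then obtain e where e: "e \<in> edges G" "p \<in> closed_edge e"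
      using p by (auto simp: realization_def)
    obtain u where u: "u \<in> e" using fin(2)[OF e(1)] by blast
    have "vpt u \<in> closed_edge e" by (rule vpt_in_closed_edge[OF fin(1)[OF e(1)] u])
    from pl_path_edge[OF e this] show ?thesis using u fin(3)[OF e(1)] by blast
  qed
  have vv: "\<exists>l. pl_path G l (vpt u) (vpt w)"
    if "(adj G)\<^sup>*\<^sup>* u w" "u \<in> verts G" for u w
    using that(1)
  proof (induction rule: rtranclp_induct)
    case base
    have "vpt u \<in> realization G" using that(2) by (simp add: realization_def)
    from pl_refl[OF this] show ?case ..
  next
    case (step y z)
    then have e: "{y, z} \<in> edges G" by (simp add: adj_def)
    have "pl_path G (edge_length {y, z} (vpt y) (vpt z)) (vpt y) (vpt z)"
      by (rule pl_path_edge[OF e]) (simp_all add: vpt_in_closed_edge)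
    with step.IH show ?case by (blast intro: pl_path_trans)
  qed
  obtain u l where u: "u \<in> verts G" "pl_path G l p (vpt u)" using near[OF p] by blast
  obtain w m where w: "w \<in> verts G" "pl_path G m q (vpt w)" using near[OF q] by blast
  have "(adj G)\<^sup>*\<^sup>* u w" using G u(1) w(1) by (simp add: connected_graph_def)
  then obtain k where "pl_path G k (vpt u) (vpt w)" using vv u(1) by blast
  from pl_path_trans[OF pl_path_trans[OF u(2) this] pl_path_sym[OF w(2)]] show ?thesis ..
qed

lemma Metric_space_gdist:
  assumes G: "connected_graph G"
  shows "Metric_space (realization G) (gdist G)"
proof
  have sg: "simple_graph G" using G by (simp add: connected_graph_def)
  show "0 \<le> gdist G p q" for p q
    by (rule gdist_nonneg)
  show "gdist G p q = gdist G q p" for p q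
  proof -
    have "pl_path G l p q \<longleftrightarrow> pl_path G l q p" for l using pl_path_sym by blast
    then show ?thesis by (simp add: gdist_def)
  qed
  show "gdist G p q = 0 \<longleftrightarrow> p = q" if pq: "p \<in> realization G" "q \<in> realization G" for p q
  proof
    assume 0: "gdist G p q = 0"
    obtain l where "pl_path G l p q" using pl_path_exists[OF G pq] by blast
    then have "\<bar>p x - q x\<bar> \<le> gdist G p q" for x
      by (rule gdist_greatest) (rule pl_path_coord[OF sg])
    then show "p = q" using 0 by (intro ext) auto
  next
    assume "p = q"
    then have "gdist G p q \<le> 0" using gdist_le pl_refl pq by blast
    then show "gdist G p q = 0" using gdist_nonneg[of G p q] by linarith
  qed
  show "gdist G p r \<le> gdist G p q + gdist G q r"
    if p: "p \<in> realization G" and q: "q \<in> realization G" and r: "r \<in> realization G" for p q r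
  proof -
    obtain l0 where l0: "pl_path G l0 p q" using pl_path_exists[OF G p q] by blast
    obtain m0 where m0: "pl_path G m0 q r" using pl_path_exists[OF G q r] by blast
    have le: "gdist G p r \<le> l + m" if "pl_path G l p q" "pl_path G m q r" for l m
      by (rule gdist_le[OF pl_path_trans[OF that]])
    have "gdist G p r - m \<le> gdist G p q" if m: "pl_path G m q r" for m
      by (rule gdist_greatest[OF l0]) (use le[OF _ m] in \<open>simp add: algebra_simps\<close>)
    then have "gdist G p r - gdist G p q \<le> gdist G q r"
      by (intro gdist_greatest[OF m0]) (simp add: algebra_simps)
    then show ?thesis by simp
  qed
qed

end

theory Submission
  imports Defs
begin

text \<open>
  Let \<open>S\<close> be the maximal geodesically complete subtree. Every edge of \<open>T\<close> outside \<open>S\<close> lies in the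
  block of a vertex of \<open>S\<close>, that is, in the union of the branches leaving \<open>S\<close> there, and the
  components of the closure of \<open>T - S\<close> are exactly the nontrivial blocks.

  Given a finite set \<open>A\<close>, let \<open>F\<close> be the set of blocks inside \<open>A\<close> and \<open>Q\<close> the set of the other blocks
  meeting \<open>A\<close>. The boundary of \<open>A\<close> meets every block in \<open>Q\<close> and every block over the boundary of \<open>F\<close>
  in \<open>S\<close>, so it has at least \<open>max (h(S) |F|) |Q|\<close> points, whereas \<open>|A| \<le> C |F| + (C - 1) |Q|\<close>. This
  gives the middle inequality; \<open>h(S) \<ge> 1 / (2 K)\<close> gives the last one, and filling up the blocks over
  a subset of \<open>S\<close> gives \<open>h(T) \<le> h(S)\<close>.

  Conversely, if \<open>h(T) > 0\<close>, then a vertex with infinitely many descendants has a child with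
  infinitely many descendants: otherwise arbitrarily large finite unions of branches below it would
  have a single boundary point. Hence such a vertex lies on a ray and therefore in \<open>S\<close>. So all
  branches off \<open>S\<close> are finite, and the same argument bounds the blocks uniformly.
\<close>

section \<open>Hop distance in connected graphs and trees\<close>

text \<open>Combinatorial counterpart of \<open>gdist\<close> on vertices
  (\<open>gdist_vpt\<close>); meaningful only for vertices joined by a path.\<close>

definition hop :: "'a ugraph \<Rightarrow> 'a \<Rightarrow> 'a \<Rightarrow> nat" where
  "hop G x y = (LEAST n. (adj G ^^ n) x y)"

text \<open>The parent comes first, so \<open>child G v ^^ k\<close> leads from a vertex to its
  descendants \<open>k\<close> levels further from the root \<open>v\<close>.\<close>

definition child :: "'a ugraph \<Rightarrow> 'a \<Rightarrow> 'a \<Rightarrow> 'a \<Rightarrow> bool" where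
  "child G v y x \<longleftrightarrow> adj G y x \<and> hop G v x = Suc (hop G v y)"

lemma adj_sym: "adj G x y \<longleftrightarrow> adj G y x"
  by (simp add: adj_def insert_commute)

lemma adjD:
  assumes "simple_graph G" "adj G x y"
  shows "x \<in> verts G" "y \<in> verts G" "x \<noteq> y"
proof -
  have "{x, y} \<subseteq> verts G \<and> card {x, y} = 2" using assms unfolding simple_graph_def adj_def by blast
  then show "x \<in> verts G" "y \<in> verts G" "x \<noteq> y" by auto
qed

lemma simple_if_connected: "connected_graph G \<Longrightarrow> simple_graph G"
  by (simp add: connected_graph_def)

lemma connected_if_tree: "tree G \<Longrightarrow> connected_graph G"
  by (simp add: tree_def)

lemma relpowp_adj_sym: "(adj G ^^ n) x y \<Longrightarrow> (adj G ^^ n) y x"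
proof (induction n arbitrary: y)
  case (Suc n)
  then obtain z where "(adj G ^^ n) x z" "adj G z y" by auto
  with Suc.IH show ?case by (metis adj_sym relpowp_Suc_I2)
qed simp

lemma hop_le: "(adj G ^^ n) x y \<Longrightarrow> hop G x y \<le> n"
  unfolding hop_def by (rule Least_le)

lemma hop_self [simp]: "hop G x x = 0"
  using hop_le[of 0 G x x] by simp

lemma hop_sym: "hop G x y = hop G y x"
proof -
  have "(adj G ^^ n) x y \<longleftrightarrow> (adj G ^^ n) y x" for n
    by (rule iffI) (erule relpowp_adj_sym)+
  then show ?thesis by (simp add: hop_def)
qed

context
  fixes G :: "'a ugraph"
  assumes G: "connected_graph G"
begin

lemma hop_path:
  assumes "x \<in> verts G" "y \<in> verts G"
  shows "(adj G ^^ hop G x y) x y"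
proof -
  have "(adj G)\<^sup>*\<^sup>* x y" using G assms by (simp add: connected_graph_def)
  then obtain n where "(adj G ^^ n) x y" by (auto dest: rtranclp_imp_relpowp)
  then show ?thesis unfolding hop_def by (rule LeastI)
qed

lemma hop_eq_0: "x \<in> verts G \<Longrightarrow> y \<in> verts G \<Longrightarrow> hop G x y = 0 \<longleftrightarrow> x = y"
  using hop_path[of x y] by auto

lemma hop_triangle:
  assumes "x \<in> verts G" "y \<in> verts G" "z \<in> verts G"
  shows "hop G x z \<le> hop G x y + hop G y z"
  by (rule hop_le) (rule relpowp_trans[OF hop_path[OF assms(1,2)] hop_path[OF assms(2,3)]])

lemma hop_adj: "adj G x y \<Longrightarrow> hop G x y = 1"
  using hop_le[of 1 G x y] hop_eq_0[of x y] adjD[OF simple_if_connected[OF G], of x y]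
  by (metis One_nat_def le_Suc_eq le_zero_eq relpowp_1)

lemma hop_step:
  assumes "x \<in> verts G" "adj G y z"
  shows "hop G x z \<le> Suc (hop G x y)"
  using hop_triangle[of x y z] hop_adj[of y z] assms adjD[OF simple_if_connected[OF G]] by force

lemma hop_1: "x \<in> verts G \<Longrightarrow> y \<in> verts G \<Longrightarrow> hop G x y = 1 \<longleftrightarrow> adj G x y"
  using hop_path[of x y] hop_adj[of x y] by (metis relpowp_1)

lemma child_exists:
  assumes "v \<in> verts G" "x \<in> verts G" "x \<noteq> v"
  obtains y where "child G v y x"
proof -
  obtain n where n: "hop G v x = Suc n"
    using hop_eq_0 assms by (metis not0_implies_Suc)
  then have "(adj G ^^ Suc n) v x" using hop_path assms by metis
  then obtain y where y: "(adj G ^^ n) v y" "adj G y x" by auto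
  have "hop G v y \<le> n" using hop_le y by metis
  moreover have "hop G v x \<le> Suc (hop G v y)" using hop_step y assms by blast
  ultimately have "child G v y x" using n y by (simp add: child_def)
  then show thesis by (rule that)
qed

lemma childD:
  assumes "child G v y x"
  shows "y \<in> verts G" "x \<in> verts G" "adj G y x" "hop G v x = Suc (hop G v y)"
  using assms adjD[OF simple_if_connected[OF G]] by (auto simp: child_def)

text \<open>The relation records that all vertices after \<open>x\<close> are strictly closer to the
  root, so the path never returns to the level of \<open>x\<close>.\<close>

lemma descend_to_root:
  assumes "v \<in> verts G" "x \<in> verts G"
  shows "(\<lambda>a b. adj G a b \<and> hop G v b < hop G v x)\<^sup>*\<^sup>* x v"
  using assms(2)
proof (induction "hop G v x" arbitrary: x rule: less_induct)
  case less
  show ?case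
  proof (cases "x = v")
    case False
    then obtain y where y: "child G v y x" using child_exists assms less by metis
    note yD = childD[OF y]
    have "(\<lambda>a b. adj G a b \<and> hop G v b < hop G v y)\<^sup>*\<^sup>* y v" using less yD by simp
    then have "(\<lambda>a b. adj G a b \<and> hop G v b < hop G v x)\<^sup>*\<^sup>* y v"
      by (rule rtranclp_mono[THEN predicate2D, rotated]) (use yD in auto)
    then show ?thesis using yD by (intro converse_rtranclp_into_rtranclp[of _ x y]) (auto simp: adj_sym)
  qed simp
qed

end

section \<open>Acyclicity: levels and parents in a tree\<close>

lemma rtranclp_distinct_path:
  assumes "R\<^sup>*\<^sup>* x y"
  shows "\<exists>us. us \<noteq> [] \<and> distinct us \<and> successively R us \<and> hd us = x \<and> last us = y"
  using assms
proof (induction rule: converse_rtranclp_induct)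
  case base
  show ?case by (rule exI[of _ "[y]"]) simp
next
  case (step x z)
  then obtain us where us: "us \<noteq> []" "distinct us" "successively R us" "hd us = z" "last us = y"
    by blast
  show ?case
  proof (cases "x \<in> set us")
    case True
    \<comment> \<open>Loop erasure: the new start already occurs, so the list is cut back to that
      occurrence.\<close>
    then obtain ps qs where ps: "us = ps @ x # qs" by (auto simp: in_set_conv_decomp)
    then show ?thesis using us
      by (intro exI[of _ "x # qs"]) (auto simp: successively_append_iff)
  next
    case False
    then show ?thesis using us step by (intro exI[of _ "x # us"]) (auto simp: successively_Cons)
  qed
qed

text \<open>A distinct path from \<open>a\<close> to \<open>b\<close> that avoids \<open>x\<close>
  has at least two vertices and closes up through \<open>x\<close>. The relation restricts only the
  targets of steps, which is why \<open>a \<noteq> x\<close> is a separate assumption.\<close>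

lemma cycle_through:
  assumes "adj G x a" "adj G x b" "a \<noteq> b" "a \<noteq> x" "(\<lambda>y z. adj G y z \<and> z \<noteq> x)\<^sup>*\<^sup>* a b"
  shows "\<exists>us. is_cycle G us"
proof -
  obtain us where us: "us \<noteq> []" "distinct us" "successively (\<lambda>y z. adj G y z \<and> z \<noteq> x) us"
    "hd us = a" "last us = b"
    using rtranclp_distinct_path[OF assms(5)] by blast
  have "successively (\<lambda>y z. adj G y z \<and> z \<noteq> x) us \<Longrightarrow> x \<noteq> hd us \<Longrightarrow> x \<notin> set us"
    by (induction us) (auto simp: successively_Cons)
  then have "x \<notin> set us" using us assms by auto
  moreover have "2 \<le> length us"
  proof (rule ccontr)
    assume "\<not> 2 \<le> length us"
    then have "length us = 1" using us(1) by (cases us) (auto simp: not_le less_Suc_eq_le)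
    then obtain c where "us = [c]" by (auto simp: length_Suc_conv)
    then show False using us assms by auto
  qed
  moreover have "successively (adj G) us" using us(3) by (rule successively_mono) simp
  ultimately have "is_cycle G (x # us)"
    using us assms by (auto simp: is_cycle_def successively_Cons adj_sym)
  then show ?thesis ..
qed

context
  fixes G :: "'a ugraph"
  assumes G: "tree G"
begin

text \<open>Both \<open>a\<close> and \<open>b\<close> reach the root through vertices other than
  \<open>x\<close>; for \<open>a \<noteq> b\<close> the two paths join to a walk avoiding
  \<open>x\<close>, which closes to a cycle. Uniqueness of parents and the absence of edges inside a
  level both follow from this.\<close>

lemma no_detour:
  assumes v: "v \<in> verts G" and a: "adj G x a" "hop G v a \<le> hop G v x"
    and b: "adj G x b" "hop G v b \<le> hop G v x"
  shows "a = b"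
proof (rule ccontr)
  assume ne: "a \<noteq> b"
  note c = connected_if_tree[OF G]
  note D = adjD[OF simple_if_connected[OF c]]
  let ?R = "\<lambda>y z. adj G y z \<and> z \<noteq> x"
  have to_root: "?R\<^sup>*\<^sup>* y v" if "adj G x y" "hop G v y \<le> hop G v x" for y
    by (rule rtranclp_mono[THEN predicate2D, OF _ descend_to_root[OF c v, of y]])
      (use that D in auto)
  have from_root: "?R\<^sup>*\<^sup>* v y" if y: "adj G x y" "hop G v y \<le> hop G v x" for y
  proof -
    have *: "(\<lambda>p q. adj G p q \<and> hop G v q < hop G v y)\<^sup>*\<^sup>* y z \<Longrightarrow> ?R\<^sup>*\<^sup>* z y" for z
    proof (induction rule: rtranclp_induct)
      case (step p q)
      have "p = y \<or> hop G v p < hop G v y"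
        using step(1) by (induction rule: rtranclp_induct) auto
      then have "p \<noteq> x" using y D(3)[of x y] by auto
      then show ?case using step by (intro converse_rtranclp_into_rtranclp[of _ q p]) (auto simp: adj_sym)
    qed simp
    show ?thesis using *[OF descend_to_root[OF c v, of y]] D y by auto
  qed
  have "?R\<^sup>*\<^sup>* a b" using to_root[OF a] from_root[OF b] by (rule rtranclp_trans)
  then have "\<exists>us. is_cycle G us" using cycle_through[of G x a b] a b ne D(3)[of x a] by auto
  then show False using G by (simp add: tree_def)
qed

lemma hop_adj_neq:
  assumes v: "v \<in> verts G" and xy: "adj G x y"
  shows "hop G v x \<noteq> hop G v y"
proof
  assume eq: "hop G v x = hop G v y"
  note c = connected_if_tree[OF G]
  note D = adjD[OF simple_if_connected[OF c] xy]
  have "x \<noteq> v" using hop_eq_0[OF c] D eq by auto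
  then obtain z where z: "child G v z x" using child_exists[OF c v] D by metis
  have "z = y"
    by (rule no_detour[OF v, of x]) (use childD[OF c z] eq xy in \<open>auto simp: adj_sym\<close>)
  then show False using childD[OF c z] eq by simp
qed

lemma child_cases:
  assumes v: "v \<in> verts G" and xy: "adj G x y"
  obtains "child G v x y" | "child G v y x"
proof -
  note c = connected_if_tree[OF G]
  have "hop G v x \<noteq> hop G v y" using hop_adj_neq assms by blast
  moreover have "hop G v y \<le> Suc (hop G v x)" "hop G v x \<le> Suc (hop G v y)"
    using hop_step[OF c v] xy by (auto simp: adj_sym)
  ultimately show thesis using that xy by (auto simp: child_def adj_sym le_Suc_eq)
qed

lemma parent_unique:
  assumes v: "v \<in> verts G" and "child G v a x" "child G v b x"
  shows "a = b"
  by (rule no_detour[OF v, of x]) (use assms in \<open>auto simp: child_def adj_sym\<close>)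

lemma ancestor_unique:
  assumes v: "v \<in> verts G" and "(child G v ^^ k) a x" "(child G v ^^ k) b x"
  shows "a = b"
  using assms(2,3)
proof (induction k arbitrary: x)
  case (Suc k)
  then show ?case using parent_unique[OF v] by (metis relpowp_Suc_E)
qed simp

lemma hop_descendant:
  "(child G v ^^ k) a b \<Longrightarrow> hop G v b = hop G v a + k"
  by (induction k arbitrary: b) (auto simp: child_def)

lemma descendant_vert:
  "a \<in> verts G \<Longrightarrow> (child G v ^^ k) a b \<Longrightarrow> b \<in> verts G"
  by (induction k arbitrary: b) (auto dest: childD[OF connected_if_tree[OF G]])

text \<open>A step changes the level by at most one, so a walk of length \<open>k\<close> that gains
  \<open>k\<close> levels must descend at every step. This translates between descendants and
  distances.\<close>

lemma descendant_iff_hop: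
  assumes v: "v \<in> verts G" and a: "a \<in> verts G" and b: "b \<in> verts G"
  shows "(child G v ^^ k) a b \<longleftrightarrow> hop G a b = k \<and> hop G v b = hop G v a + k"
proof
  note c = connected_if_tree[OF G]
  assume k: "(child G v ^^ k) a b"
  have "(adj G ^^ k) a b"
    by (rule relpowp_mono[OF _ k]) (simp add: child_def)
  then have "hop G a b \<le> k" by (rule hop_le)
  then show "hop G a b = k \<and> hop G v b = hop G v a + k"
    using hop_descendant[OF k] hop_triangle[OF c v a b] by linarith
next
  note c = connected_if_tree[OF G]
  have *: "(adj G ^^ k) a b \<Longrightarrow> hop G v b \<le> hop G v a + k \<and> (hop G v b = hop G v a + k \<longrightarrow> (child G v ^^ k) a b)"
    for k b
  proof (induction k arbitrary: b)
    case (Suc k)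
    then obtain z where z: "(adj G ^^ k) a z" "adj G z b" by auto
    have "hop G v b \<le> Suc (hop G v z)" using hop_step[OF c v z(2)] .
    then show ?case using Suc.IH[OF z(1)] z(2) by (auto simp: child_def)
  qed simp
  assume "hop G a b = k \<and> hop G v b = hop G v a + k"
  then show "(child G v ^^ k) a b" using *[of k b] hop_path[OF c a b] by auto
qed

lemma descendant_of_root:
  assumes v: "v \<in> verts G" and x: "x \<in> verts G"
  shows "(child G v ^^ hop G v x) v x"
  using descendant_iff_hop[OF v v x] by simp

end

section \<open>Points on edges and piecewise affine functions\<close>

text \<open>Arc length parametrization of the edge from \<open>a\<close> to
  \<open>b\<close>.\<close>

definition pt :: "'a \<Rightarrow> 'a \<Rightarrow> real \<Rightarrow> 'a \<Rightarrow> real" where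
  "pt a b s = (\<lambda>x. (1 - s) * vpt a x + s * vpt b x)"

text \<open>Affine extension of a vertex function to the realization. Summing over the support,
  which is finite at points of the realization of a simple graph, avoids naming the edge that
  contains \<open>p\<close>.\<close>

definition lin :: "('a \<Rightarrow> real) \<Rightarrow> ('a \<Rightarrow> real) \<Rightarrow> real" where
  "lin \<phi> p = (\<Sum>x | p x \<noteq> 0. p x * \<phi> x)"

lemma pt_0 [simp]: "pt a b 0 = vpt a" and pt_1 [simp]: "pt a b 1 = vpt b"
  by (simp_all add: pt_def)

lemma pt_swap: "pt a b s = pt b a (1 - s)"
  by (simp add: pt_def add.commute)

lemma vpt_inj [simp]: "vpt a = vpt b \<longleftrightarrow> a = b"
  by (auto simp: vpt_def fun_eq_iff split: if_splits)

lemma lin_pt: "a \<noteq> b \<Longrightarrow> lin \<phi> (pt a b s) = (1 - s) * \<phi> a + s * \<phi> b"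
proof -
  assume ab: "a \<noteq> b"
  have "lin \<phi> (pt a b s) = (\<Sum>x\<in>{a, b}. pt a b s x * \<phi> x)"
    unfolding lin_def by (rule sum.mono_neutral_left) (auto simp: pt_def vpt_def)
  then show ?thesis using ab by (simp add: pt_def vpt_def)
qed

lemma lin_vpt [simp]: "lin \<phi> (vpt a) = \<phi> a"
proof -
  have "{x. vpt a x \<noteq> 0} = {a}" by (auto simp: vpt_def)
  then show ?thesis by (simp add: lin_def) (simp add: vpt_def)
qed

lemma pt_in_closed_edge: "a \<noteq> b \<Longrightarrow> 0 \<le> s \<Longrightarrow> s \<le> 1 \<Longrightarrow> pt a b s \<in> closed_edge {a, b}"
  by (auto simp: closed_edge_def pt_def vpt_def)

lemma closed_edge_pt:
  assumes "a \<noteq> b" "p \<in> closed_edge {a, b}"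
  shows "p = pt a b (p b)" "0 \<le> p b" "p b \<le> 1"
proof -
  have *: "\<And>x. 0 \<le> p x" "\<And>x. x \<notin> {a, b} \<Longrightarrow> p x = 0" "p a + p b = 1"
    using assms by (auto simp: closed_edge_def)
  show "p = pt a b (p b)"
    using * assms(1) by (auto simp: pt_def vpt_def fun_eq_iff)
  show "0 \<le> p b" "p b \<le> 1" using *(1)[of a] *(1)[of b] *(3) by auto
qed

lemma simple_graph_edge:
  assumes "simple_graph G" "e \<in> edges G"
  obtains a b where "e = {a, b}" "a \<noteq> b" "adj G a b"
proof -
  have "card e = 2" using assms by (simp add: simple_graph_def)
  then obtain a b where "e = {a, b}" "a \<noteq> b" by (auto simp: card_2_iff)
  with that show thesis using assms by (simp add: adj_def)
qed

lemma vpt_realization: "a \<in> verts G \<Longrightarrow> vpt a \<in> realization G"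
  by (simp add: realization_def)

lemma pt_realization:
  assumes "simple_graph G" "adj G a b" "0 \<le> s" "s \<le> 1"
  shows "pt a b s \<in> realization G"
  using pt_in_closed_edge[of a b s] adjD[OF assms(1,2)] assms by (auto simp: realization_def adj_def)

lemma realization_cases:
  assumes G: "simple_graph G" and p: "p \<in> realization G"
  obtains (vertex) a where "a \<in> verts G" "p = vpt a"
    | (edge) a b s where "adj G a b" "0 < s" "s < 1" "p = pt a b s"
proof (cases "p \<in> vpt ` verts G")
  case False
  then obtain e where e: "e \<in> edges G" "p \<in> closed_edge e" using p by (auto simp: realization_def)
  obtain a b where ab: "e = {a, b}" "a \<noteq> b" "adj G a b" using simple_graph_edge[OF G e(1)] .
  note * = closed_edge_pt[OF ab(2) e(2)[unfolded ab(1)]]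
  have "p \<noteq> vpt a" "p \<noteq> vpt b" using False adjD[OF G ab(3)] by auto
  then have "p b \<noteq> 0" "p b \<noteq> 1" using *(1) pt_0 pt_1 by metis+
  then show thesis using edge[OF ab(3), of "p b"] * by simp
qed (use vertex in auto)

lemma edge_length_pt: "a \<noteq> b \<Longrightarrow> edge_length {a, b} (pt a b s) (pt a b t) = \<bar>s - t\<bar>"
  by (simp add: edge_length_def pt_def vpt_def)

text \<open>On one edge \<open>lin \<phi>\<close> is affine with slope of absolute value at most 1.
  This is the source of the lower bounds on \<open>gdist\<close>.\<close>

lemma lin_lipschitz_path:
  assumes G: "simple_graph G" and \<phi>: "\<And>a b. adj G a b \<Longrightarrow> \<bar>\<phi> a - \<phi> b\<bar> \<le> 1"
  shows "pl_path G l p q \<Longrightarrow> \<bar>lin \<phi> p - lin \<phi> q\<bar> \<le> l"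
proof (induction rule: pl_path.induct)
  case (pl_step e p q l r)
  obtain a b where ab: "e = {a, b}" "a \<noteq> b" "adj G a b" using simple_graph_edge[OF G pl_step(1)] .
  note p = closed_edge_pt[OF ab(2) pl_step(2)[unfolded ab(1)]]
  note q = closed_edge_pt[OF ab(2) pl_step(3)[unfolded ab(1)]]
  have "lin \<phi> p - lin \<phi> q = (p b - q b) * (\<phi> b - \<phi> a)"
    using lin_pt[OF ab(2), of \<phi> "p b"] lin_pt[OF ab(2), of \<phi> "q b"] p(1) q(1)
    by (simp add: algebra_simps)
  then have "\<bar>lin \<phi> p - lin \<phi> q\<bar> = \<bar>p b - q b\<bar> * \<bar>\<phi> b - \<phi> a\<bar>" by (simp add: abs_mult)
  also have "\<dots> \<le> \<bar>p b - q b\<bar> * 1"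
    using \<phi>[OF ab(3)] by (intro mult_left_mono) (auto simp: abs_minus_commute)
  also have "\<dots> = edge_length e p q"
    using edge_length_pt[OF ab(2), of "p b" "q b"] p(1) q(1) ab(1) by simp
  finally show ?case using pl_step.IH by linarith
qed simp

section \<open>Geodesics in the realization\<close>

text \<open>Unit-speed parametrization of the edge path \<open>R 0\<close>, \<open>R 1\<close>, and
  so on, meant for \<open>s \<ge> 0\<close>.\<close>

definition along :: "(nat \<Rightarrow> 'b) \<Rightarrow> real \<Rightarrow> 'b \<Rightarrow> real" where
  "along R s = pt (R (nat \<lfloor>s\<rfloor>)) (R (Suc (nat \<lfloor>s\<rfloor>))) (frac s)"

lemma along_nat [simp]: "along R (real n) = vpt (R n)"
  by (simp add: along_def frac_def)

text \<open>At \<open>s = real (Suc n)\<close> the floor has already jumped to the next edge, but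
  both edges give the vertex \<open>R (Suc n)\<close> there.\<close>

lemma along_between:
  assumes "real n \<le> s" "s \<le> real (Suc n)"
  shows "along R s = pt (R n) (R (Suc n)) (s - n)"
proof (cases "s = real (Suc n)")
  case False
  then have "\<lfloor>s\<rfloor> = int n" using assms by (simp add: floor_eq_iff)
  then show ?thesis by (simp add: along_def frac_def)
next
  case True
  then show ?thesis by (metis along_nat add_diff_cancel_left' of_nat_Suc pt_1 add.commute)
qed

lemma along_cong:
  assumes "\<And>i. i \<le> N \<Longrightarrow> R i = R' i" "0 \<le> s" "s \<le> real N"
  shows "along R s = along R' s"
proof (cases "s = N")
  case False
  define n where "n = nat \<lfloor>s\<rfloor>"
  have n: "real n \<le> s" "s < real (Suc n)" using assms by (simp_all add: n_def) linarith+
  moreover have "n < N" using n assms False by linarith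
  ultimately show ?thesis
    using along_between[of n s R] along_between[of n s R'] assms(1)[of n] assms(1)[of "Suc n"] by simp
qed (use assms in simp)

text \<open>Only the first \<open>N\<close> steps are constrained, so finite paths and rays share
  one notion: a ray is a \<open>geoseq\<close> for every \<open>N\<close>.\<close>

definition geoseq :: "'a ugraph \<Rightarrow> 'a \<Rightarrow> (nat \<Rightarrow> 'a) \<Rightarrow> nat \<Rightarrow> bool" where
  "geoseq G v R N \<longleftrightarrow> R 0 = v \<and> (\<forall>i<N. child G v (R i) (R (Suc i)))"

lemma isometric_embeddingD:
  assumes "isometric_embedding I G f" "s \<in> I"
  shows "f s \<in> realization G" "s' \<in> I \<Longrightarrow> gdist G (f s) (f s') = \<bar>s - s'\<bar>"
  using assms by (auto simp: isometric_embedding_def)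

context
  fixes G :: "'a ugraph"
  assumes G: "connected_graph G"
begin

interpretation M: Metric_space "realization G" "gdist G"
  by (rule Metric_space_gdist[OF G])

lemma lin_lipschitz:
  assumes "\<And>a b. adj G a b \<Longrightarrow> \<bar>\<phi> a - \<phi> b\<bar> \<le> 1" "p \<in> realization G" "q \<in> realization G"
  shows "\<bar>lin \<phi> p - lin \<phi> q\<bar> \<le> gdist G p q"
proof -
  obtain l where "pl_path G l p q" using pl_path_exists[OF G assms(2,3)] by blast
  then show ?thesis
    by (rule gdist_greatest) (rule lin_lipschitz_path[OF simple_if_connected[OF G] assms(1)])
qed

lemma gdist_pt_le:
  assumes "adj G a b" "0 \<le> s" "s \<le> 1" "0 \<le> t" "t \<le> 1"
  shows "gdist G (pt a b s) (pt a b t) \<le> \<bar>s - t\<bar>"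
proof -
  have ab: "a \<noteq> b" using adjD[OF simple_if_connected[OF G] assms(1)] by simp
  have "pl_path G (edge_length {a, b} (pt a b s) (pt a b t)) (pt a b s) (pt a b t)"
    using assms ab by (intro pl_path_edge pt_in_closed_edge) (auto simp: adj_def)
  from gdist_le[OF this] show ?thesis by (simp add: edge_length_pt ab)
qed

lemma hop_lipschitz:
  assumes "y \<in> verts G" "adj G a b"
  shows "\<bar>real (hop G y a) - real (hop G y b)\<bar> \<le> 1"
  using hop_step[OF G assms] hop_step[OF G assms(1), of b a] assms(2) by (auto simp: adj_sym)

text \<open>Walking along edges gives the upper bound; the lower bound holds because the hop
  distance from \<open>a\<close> is 1-Lipschitz.\<close>

lemma gdist_vpt:
  assumes a: "a \<in> verts G" and b: "b \<in> verts G"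
  shows "gdist G (vpt a) (vpt b) = hop G a b"
proof (rule antisym)
  have "(adj G ^^ n) a b \<Longrightarrow> b \<in> verts G \<Longrightarrow> gdist G (vpt a) (vpt b) \<le> n" for n
  proof (induction n arbitrary: b)
    case 0
    then show ?case using M.zero[of "vpt a" "vpt b"] a by (simp add: vpt_realization)
  next
    case (Suc n)
    then obtain z where z: "(adj G ^^ n) a z" "adj G z b" by auto
    note D = adjD[OF simple_if_connected[OF G] z(2)]
    have "gdist G (vpt z) (vpt b) \<le> 1" using gdist_pt_le[OF z(2), of 0 1] by simp
    then show ?case using Suc.IH[OF z(1)] D a M.triangle[of "vpt a" "vpt z" "vpt b"]
      by (simp add: vpt_realization)
  qed
  then show "gdist G (vpt a) (vpt b) \<le> hop G a b" using hop_path[OF G a b] b by blast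
  show "hop G a b \<le> gdist G (vpt a) (vpt b)"
    using lin_lipschitz[of "\<lambda>x. real (hop G a x)" "vpt a" "vpt b"] hop_lipschitz a b
    by (simp add: vpt_realization)
qed

lemma continuous_lin:
  assumes "\<And>a b. adj G a b \<Longrightarrow> \<bar>\<phi> a - \<phi> b\<bar> \<le> 1"
  shows "continuous_map (gtop G) euclideanreal (lin \<phi>)"
  unfolding gtop_def M.continuous_map_from_metric
proof (intro conjI ballI allI impI)
  fix p U assume p: "p \<in> realization G" and U: "openin euclideanreal U \<and> lin \<phi> p \<in> U"
  then obtain e where e: "e > 0" "ball (lin \<phi> p) e \<subseteq> U" by (auto simp: open_contains_ball)
  show "\<exists>r>0. \<forall>x. x \<in> realization G \<and> gdist G p x < r \<longrightarrow> lin \<phi> x \<in> U"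
  proof (intro exI[of _ e] conjI allI impI)
    fix q assume q: "q \<in> realization G \<and> gdist G p q < e"
    then have "\<bar>lin \<phi> p - lin \<phi> q\<bar> < e" using lin_lipschitz[of \<phi> p q] assms p by auto
    then show "lin \<phi> q \<in> U" using e by (auto simp: dist_real_def)
  qed (use e in simp)
qed auto

lemma continuous_pt:
  assumes "adj G a b"
  shows "continuous_map (top_of_set {0..1}) (gtop G) (pt a b)"
  unfolding gtop_def M.continuous_map_to_metric
proof (intro ballI allI impI)
  fix s e :: real assume s: "s \<in> topspace (top_of_set {0..1})" and e: "e > 0"
  show "\<exists>U. openin (top_of_set {0..1}) U \<and> s \<in> U \<and> (\<forall>t\<in>U. pt a b t \<in> M.mball (pt a b s) e)"
  proof (intro exI conjI ballI)
    show "openin (top_of_set {0..1}) ({0..1} \<inter> ball s e)" by (simp add: openin_open_Int)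
    show "s \<in> {0..1} \<inter> ball s e" using s e by simp
    fix t assume t: "t \<in> {0..1} \<inter> ball s e"
    then have "gdist G (pt a b s) (pt a b t) < e"
      using gdist_pt_le[OF assms, of s t] s by (auto simp: dist_real_def)
    then show "pt a b t \<in> M.mball (pt a b s) e"
      using s t assms pt_realization[OF simple_if_connected[OF G] assms] by (auto simp: M.in_mball)
  qed
qed

lemma geoseq_hop: "geoseq G v R N \<Longrightarrow> i \<le> N \<Longrightarrow> hop G v (R i) = i"
  by (induction i) (auto simp: geoseq_def child_def)

lemma geoseq_vert: "geoseq G v R N \<Longrightarrow> v \<in> verts G \<Longrightarrow> i \<le> N \<Longrightarrow> R i \<in> verts G"
  using childD(2)[OF G, of v "R (i - 1)" "R i"] by (cases i) (auto simp: geoseq_def)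

lemma along_cases:
  fixes s :: real
  assumes R: "geoseq G v R N" and v: "v \<in> verts G" and s: "0 \<le> s" "s \<le> N"
  obtains "s = N" | n where "n < N" "real n \<le> s" "s < real (Suc n)" "adj G (R n) (R (Suc n))"
    "along R s = pt (R n) (R (Suc n)) (s - n)"
proof (cases "s = N")
  case False
  define n where "n = nat \<lfloor>s\<rfloor>"
  have n: "real n \<le> s" "s < real (Suc n)" using s by (simp_all add: n_def) linarith+
  then have "n < N" using s False by linarith
  moreover have "adj G (R n) (R (Suc n))" using R \<open>n < N\<close> by (auto simp: geoseq_def child_def)
  ultimately show thesis using that(2) n along_between[of n s R] by simp
qed

lemma along_realization:
  assumes R: "geoseq G v R N" and v: "v \<in> verts G" and s: "0 \<le> s" "s \<le> real N"
  shows "along R s \<in> realization G"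
proof (rule along_cases[OF R v s])
  assume "s = N"
  then show ?thesis using geoseq_vert[OF R v] by (simp add: vpt_realization)
next
  fix n assume "n < N" "real n \<le> s" "s < real (Suc n)" "adj G (R n) (R (Suc n))"
    "along R s = pt (R n) (R (Suc n)) (s - n)"
  then show ?thesis using pt_realization[OF simple_if_connected[OF G], of "R n" "R (Suc n)" "s - n"] by simp
qed

lemma lin_along:
  assumes R: "geoseq G v R N" and v: "v \<in> verts G" and s: "0 \<le> s" "s \<le> real N"
  shows "lin (\<lambda>x. real (hop G v x)) (along R s) = s"
proof (rule along_cases[OF R v s])
  assume "s = N"
  then show ?thesis using geoseq_hop[OF R] by simp
next
  fix n assume n: "n < N" "real n \<le> s" "s < real (Suc n)" "adj G (R n) (R (Suc n))"
    "along R s = pt (R n) (R (Suc n)) (s - n)"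
  have "hop G v (R n) = n" "hop G v (R (Suc n)) = Suc n" using geoseq_hop[OF R] n by auto
  then show ?thesis using n adjD[OF simple_if_connected[OF G] n(4)] by (simp add: lin_pt algebra_simps)
qed

lemma gdist_along_le:
  assumes R: "geoseq G v R N" and v: "v \<in> verts G" and s: "0 \<le> s" "s \<le> s'" "s' \<le> real N"
  shows "gdist G (along R s) (along R s') \<le> s' - s"
proof -
  have step: "gdist G (along R s) (along R s') \<le> s' - s"
    if "real n \<le> s" "s \<le> s'" "s' \<le> real (Suc n)" "n < N" for n s s'
  proof -
    have "adj G (R n) (R (Suc n))" using R that by (auto simp: geoseq_def child_def)
    from gdist_pt_le[OF this, of "s - n" "s' - n"] show ?thesis
      using that along_between[of n s R] along_between[of n s' R] by simp
  qed
  \<comment> \<open>Induction on an integer bound for \<open>s'\<close>, splitting the path at the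
    vertex \<open>R m\<close> if it lies strictly between the two points.\<close>
  have "s' \<le> real m \<Longrightarrow> m \<le> N \<Longrightarrow> s \<le> s' \<Longrightarrow> gdist G (along R s) (along R s') \<le> s' - s" for m s'
  proof (induction m arbitrary: s')
    case 0
    then have "s = 0" "s' = 0" using s by auto
    then show ?case using M.zero[of "along R 0" "along R 0"] along_realization[OF R v, of 0] by simp
  next
    case (Suc m)
    consider "s' \<le> real m" | "real m \<le> s" | "s < real m" "real m < s'" by linarith
    then show ?case
    proof cases
      case 1
      then show ?thesis using Suc by simp
    next
      case 2
      then show ?thesis using Suc by (intro step[of m]) auto
    next
      case 3
      have "gdist G (along R s) (along R (real m)) \<le> m - s"
        using Suc.IH[of "real m"] Suc.prems 3 by (auto simp del: along_nat)
      moreover have "gdist G (along R (real m)) (along R s') \<le> s' - m"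
        using Suc 3 by (intro step[of m]) auto
      moreover have "gdist G (along R s) (along R s')
          \<le> gdist G (along R s) (along R (real m)) + gdist G (along R (real m)) (along R s')"
        using Suc 3 s by (intro M.triangle along_realization[OF R v]) auto
      ultimately show ?thesis by linarith
    qed
  qed
  from this[of s' N] show ?thesis using s by simp
qed

text \<open>The level function is 1-Lipschitz and equals the parameter along the path
  (\<open>lin_along\<close>), so the upper bound given by the length of the path is
  attained.\<close>

lemma isometric_along:
  assumes R: "geoseq G v R N" and v: "v \<in> verts G"
  shows "isometric_embedding {0..real N} G (along R)"
  unfolding isometric_embedding_def
proof (intro conjI ballI)
  show "along R ` {0..real N} \<subseteq> realization G" using along_realization[OF R v] by auto
  have *: "gdist G (along R s) (along R s') = \<bar>s - s'\<bar>" if "s \<le> s'" "0 \<le> s" "s' \<le> real N" for s s'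
  proof (rule antisym)
    show "gdist G (along R s) (along R s') \<le> \<bar>s - s'\<bar>" using gdist_along_le[OF R v, of s s'] that by auto
    show "\<bar>s - s'\<bar> \<le> gdist G (along R s) (along R s')"
      using lin_lipschitz[of "\<lambda>x. real (hop G v x)", OF hop_lipschitz[OF v], of "along R s" "along R s'"]
        lin_along[OF R v] along_realization[OF R v] that by auto
  qed
  fix s s' assume "s \<in> {0..real N}" "s' \<in> {0..real N}"
  then show "gdist G (along R s) (along R s') = \<bar>s - s'\<bar>"
    using *[of s s'] *[of s' s] M.commute[of "along R s" "along R s'"] by (cases "s \<le> s'") auto
qed

lemma isometric_along_ray:
  assumes R: "\<And>N. geoseq G v R N" and v: "v \<in> verts G"
  shows "isometric_embedding {0..} G (along R)"
  unfolding isometric_embedding_def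
proof (intro conjI ballI)
  show "along R ` {0..} \<subseteq> realization G"
  proof clarsimp
    fix s :: real assume "0 \<le> s"
    then show "along R s \<in> realization G"
      using along_realization[OF R v, of s "nat \<lceil>s\<rceil>"] by linarith
  qed
  fix s s' :: real assume "s \<in> {0..}" "s' \<in> {0..}"
  moreover define N where "N = nat \<lceil>max s s'\<rceil>"
  ultimately have "s \<in> {0..real N}" "s' \<in> {0..real N}" by (auto simp: max_def) linarith+
  then show "gdist G (along R s) (along R s') = \<bar>s - s'\<bar>"
    using isometric_along[OF R v, of N] by (simp add: isometric_embedding_def)
qed

end

section \<open>Geodesics from the root of a tree\<close>

context
  fixes G :: "'a ugraph" and v :: 'a
  assumes rooted: "rooted_tree G v"
begin

lemma root_tree: "tree G" and root_vert: "v \<in> verts G"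
  using rooted by (auto simp: rooted_tree_def)

lemmas root_connected = connected_if_tree[OF root_tree]
lemmas root_simple = simple_if_connected[OF root_connected]

interpretation M: Metric_space "realization G" "gdist G"
  by (rule Metric_space_gdist[OF root_connected])

lemma geoseq_descendant:
  assumes "geoseq G v R N" "i \<le> N"
  shows "(child G v ^^ (N - i)) (R i) (R N)"
  unfolding relpowp_fun_conv
  by (rule exI[of _ "\<lambda>j. R (i + j)"]) (use assms in \<open>auto simp: geoseq_def\<close>)

lemma geoseq_exists:
  assumes "x \<in> verts G"
  obtains R where "geoseq G v R (hop G v x)" "R (hop G v x) = x"
proof -
  have "(child G v ^^ hop G v x) v x"
    by (rule descendant_of_root[OF root_tree root_vert assms])
  then show thesis using that unfolding relpowp_fun_conv geoseq_def by auto
qed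

lemma geoseq_ancestor:
  assumes "geoseq G v R N" "(child G v ^^ k) a (R N)" "k \<le> N"
  shows "a = R (N - k)"
  using ancestor_unique[OF root_tree root_vert assms(2)] geoseq_descendant[OF assms(1), of "N - k"] assms(3)
  by simp

lemma gdist_root_along:
  assumes "geoseq G v R N" "0 \<le> s" "s \<le> real N"
  shows "gdist G (vpt v) (along R s) = s"
proof -
  have "along R 0 = vpt v" using assms(1) along_nat[of R 0] by (simp add: geoseq_def)
  moreover have "gdist G (along R 0) (along R s) = \<bar>0 - s\<bar>"
    using isometric_embeddingD(2)[OF isometric_along[OF root_connected assms(1) root_vert], of 0 s] assms(2,3)
    by simp
  ultimately show ?thesis using assms by simp
qed

text \<open>An interior point of an edge lies on the path from the root to the farther end of that
  edge, and \<open>gdist_root_along\<close> identifies its parameter.\<close>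

lemma realization_along:
  assumes p: "p \<in> realization G"
  obtains (found) R N where "geoseq G v R N" "0 \<le> gdist G (vpt v) p" "gdist G (vpt v) p \<le> real N"
    "real N < gdist G (vpt v) p + 1" "p = along R (gdist G (vpt v) p)"
  using root_simple p
proof (cases rule: realization_cases)
  case (vertex a)
  obtain R where "geoseq G v R (hop G v a)" "R (hop G v a) = a" using geoseq_exists[OF vertex(1)] .
  then show ?thesis
    using found[of R "hop G v a"] vertex gdist_vpt[OF root_connected root_vert vertex(1)] by simp
next
  case (edge a b s)
  have *: thesis if ab: "child G v a b" and s: "0 < s" "s < 1" "p = pt a b s" for a b s
  proof -
    note D = childD[OF root_connected ab]
    obtain R where R: "geoseq G v R (hop G v b)" "R (hop G v b) = b" using geoseq_exists[OF D(2)] .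
    have "(child G v ^^ 1) a (R (hop G v b))" unfolding relpowp_1 R(2) by (rule ab)
    from geoseq_ancestor[OF R(1) this] have a: "R (hop G v a) = a" using D by simp
    define t where "t = real (hop G v a) + s"
    have "along R t = p"
      using along_between[of "hop G v a" t R] s a R(2) D(4) by (simp add: t_def)
    moreover have t: "0 \<le> t" "t \<le> real (hop G v b)" using s D(4) by (auto simp: t_def)
    ultimately have "gdist G (vpt v) p = t" using gdist_root_along[OF R(1) t] by simp
    then show thesis using found[OF R(1)] t s D(4) \<open>along R t = p\<close> by (simp add: t_def)
  qed
  show thesis
  proof (rule child_cases[OF root_tree root_vert edge(1)])
    assume "child G v a b" then show thesis using * edge by blast
  next
    assume "child G v b a" then show thesis using *[of b a "1 - s"] edge pt_swap[of a b s] by simp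
  qed
qed

text \<open>Each step of the path comes one closer to its end \<open>R N\<close>. In
  \<open>along_unique\<close> this is applied at the common end point of the two geodesics.\<close>

lemma lin_hop_along:
  assumes R: "geoseq G v R N" and s: "0 \<le> s" "s \<le> real N"
  shows "lin (\<lambda>x. real (hop G (R N) x)) (along R s) = N - s"
proof -
  have hop: "hop G (R N) (R i) = N - i" if "i \<le> N" for i
    using descendant_iff_hop[OF root_tree root_vert, of "R i" "R N" "N - i"] geoseq_descendant[OF R that]
      geoseq_vert[OF root_connected R root_vert] that by (simp add: hop_sym)
  show ?thesis
  proof (rule along_cases[OF root_connected R root_vert s])
    fix n assume n: "n < N" "real n \<le> s" "s < real (Suc n)" "adj G (R n) (R (Suc n))"
      "along R s = pt (R n) (R (Suc n)) (s - n)"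
    have "real (hop G (R N) (R n)) = real N - n" "real (hop G (R N) (R (Suc n))) = real N - n - 1"
      using hop[of n] hop[of "Suc n"] n by auto
    note eqs = this
    have "R n \<noteq> R (Suc n)" using adjD[OF root_simple n(4)] by simp
    then have "lin (\<lambda>x. real (hop G (R N) x)) (along R s)
        = (1 - (s - n)) * real (hop G (R N) (R n)) + (s - n) * real (hop G (R N) (R (Suc n)))"
      using n(5) by (simp add: lin_pt)
    then show ?thesis unfolding eqs by (simp add: algebra_simps)
  qed (use hop[of N] in simp)
qed

text \<open>A point whose distances to the two ends of a geodesic add up to its length lies on it: the
  sum of the two distance functions is affine on edges and minimal exactly on the geodesic.\<close>

lemma along_unique:
  assumes R: "geoseq G v R N" and t: "0 \<le> t" "t \<le> real N"
    and f: "isometric_embedding {0..t} G f" "f 0 = vpt v" "f t = along R t" and s: "s \<in> {0..t}"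
  shows "f s = along R s"
proof -
  define L where "L x = real (hop G v x)" for x
  define U where "U x = real (hop G (R N) x)" for x
  have RN: "R N \<in> verts G" using geoseq_vert[OF root_connected R root_vert] by simp
  have fr: "f ` {0..t} \<subseteq> realization G" and
    fd: "\<And>s s'. s \<in> {0..t} \<Longrightarrow> s' \<in> {0..t} \<Longrightarrow> gdist G (f s) (f s') = \<bar>s - s'\<bar>"
    using f(1) by (auto simp: isometric_embedding_def)
  have q: "f s \<in> realization G" "f t \<in> realization G" "f 0 \<in> realization G" using fr s t by auto
  have "\<bar>lin L (f 0) - lin L (f s)\<bar> \<le> gdist G (f 0) (f s)"
    using lin_lipschitz[OF root_connected, of L] hop_lipschitz[OF root_connected root_vert] q
    by (simp add: L_def)
  then have L_le: "lin L (f s) \<le> s" using fd[of 0 s] s t f(2) by (simp add: L_def)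
  have "\<bar>lin U (f s) - lin U (f t)\<bar> \<le> gdist G (f s) (f t)"
    using lin_lipschitz[OF root_connected, of U] hop_lipschitz[OF root_connected RN] q
    by (simp add: U_def)
  moreover have "lin U (f t) = N - t"
    using lin_hop_along[OF R t] f(3) by (simp add: U_def[abs_def])
  ultimately have U_le: "lin U (f s) \<le> N - s" using fd[of s t] s t by auto
  have hN: "hop G v (R N) = N" using geoseq_hop[OF root_connected R] by simp
  have LU: "N \<le> L x + U x" if "x \<in> verts G" for x
    using hop_triangle[OF root_connected root_vert that RN] hN hop_sym[of G x] by (simp add: L_def U_def)
  have on: "x = R (hop G v x)" "hop G v x \<le> N" if x: "x \<in> verts G" "L x + U x = N" for x
  proof -
    have "hop G v x + hop G x (R N) = N" using x(2) hop_sym[of G x] by (simp add: L_def U_def)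
    then show "hop G v x \<le> N" by simp
    have "(child G v ^^ (N - hop G v x)) x (R N)"
      using descendant_iff_hop[OF root_tree root_vert x(1) RN] hN \<open>hop G v x + hop G x (R N) = N\<close> by auto
    then show "x = R (hop G v x)" using geoseq_ancestor[OF R] \<open>hop G v x \<le> N\<close> by fastforce
  qed
  from root_simple q(1) show ?thesis
  proof (cases rule: realization_cases)
    case (vertex a)
    then have "L a + U a = N" "L a = s" using LU[OF vertex(1)] L_le U_le by auto
    then show ?thesis using on[OF vertex(1)] vertex(2) along_nat[of R "hop G v a"] by (simp add: L_def)
  next
    case (edge a b \<sigma>)
    have *: "f s = along R s" if ab: "child G v a b" and \<sigma>: "0 < \<sigma>" "\<sigma> < 1" and fs: "f s = pt a b \<sigma>" for a b \<sigma>
    proof -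
      note D = childD[OF root_connected ab]
      have ne: "a \<noteq> b" using adjD[OF root_simple D(3)] by simp
      have l: "lin L (f s) = (1 - \<sigma>) * L a + \<sigma> * L b" "lin U (f s) = (1 - \<sigma>) * U a + \<sigma> * U b"
        using fs lin_pt[OF ne] by auto
      \<comment> \<open>Both ends satisfy \<open>L + U \<ge> N\<close>, while the bounds at
        \<open>f s\<close> make this convex combination of the excesses nonpositive. As both weights
        are positive, the two excesses vanish.\<close>
      have sum: "(1 - \<sigma>) * (L a + U a - N) + \<sigma> * (L b + U b - N) \<le> 0"
        using l L_le U_le by (simp add: algebra_simps)
      have pos: "0 \<le> (1 - \<sigma>) * (L a + U a - N)" "0 \<le> \<sigma> * (L b + U b - N)"
        using LU[OF D(1)] LU[OF D(2)] \<sigma> by auto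
      have "(1 - \<sigma>) * (L a + U a - N) = 0" "\<sigma> * (L b + U b - N) = 0" using sum pos by linarith+
      then have eq: "L a + U a = N" "L b + U b = N" using \<sigma> by auto
      have Lb: "L b = L a + 1" using D(4) by (simp add: L_def)
      have Ls: "lin L (f s) = L a + \<sigma>" using l(1) Lb by (simp add: algebra_simps)
      have Ub: "U b = U a - 1" using eq Lb by linarith
      have "lin U (f s) = U a - \<sigma>" using l(2) Ub by (simp add: algebra_simps)
      then have "s = L a + \<sigma>" using Ls L_le U_le eq by linarith
      then show ?thesis using along_between[of "hop G v a" s R] on[OF D(1) eq(1)] on[OF D(2) eq(2)] D(4) \<sigma> fs
        by (simp add: L_def)
    qed
    show ?thesis
    proof (rule child_cases[OF root_tree root_vert edge(1)])
      assume "child G v a b" then show ?thesis using * edge by blast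
    next
      assume "child G v b a" then show ?thesis using *[of b a "1 - \<sigma>"] edge pt_swap[of a b \<sigma>] by simp
    qed
  qed
qed

section \<open>Children, completeness, poles and pseudo-regularity\<close>

lemma geoseq_extend:
  assumes ch: "\<And>x. x \<in> verts G \<Longrightarrow> \<exists>y. child G v x y" and R0: "geoseq G v R0 N"
  obtains R where "\<And>M. geoseq G v R M" "\<And>i. i \<le> N \<Longrightarrow> R i = R0 i"
proof -
  define c where "c x = (SOME y. child G v x y)" for x
  have c: "child G v x (c x)" if "x \<in> verts G" for x
    unfolding c_def by (rule someI_ex[OF ch[OF that]])
  define R where "R i = (if i \<le> N then R0 i else (c ^^ (i - N)) (R0 N))" for i
  have "(c ^^ k) (R0 N) \<in> verts G" for k
  proof (induction k)
    case 0
    then show ?case using geoseq_vert[OF root_connected R0 root_vert] by simp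
  next
    case (Suc k)
    then show ?case using childD(2)[OF root_connected c] by simp
  qed
  then have step: "child G v ((c ^^ k) (R0 N)) ((c ^^ Suc k) (R0 N))" for k using c by simp
  have "child G v (R i) (R (Suc i))" for i
  proof -
    consider "Suc i \<le> N" | "i = N" | "N < i" by linarith
    then show ?thesis
    proof cases
      case 1
      then show ?thesis using R0 by (simp add: R_def geoseq_def)
    next
      case 2
      then show ?thesis using step[of 0] by (simp add: R_def)
    next
      case 3
      then show ?thesis using step[of "i - N"] by (simp add: R_def Suc_diff_le)
    qed
  qed
  then have "geoseq G v R M" for M using R0 by (simp add: geoseq_def R_def)
  then show thesis by (rule that) (simp add: R_def)
qed

text \<open>A geodesic from the root is determined by its end point (\<open>along_unique\<close>),
  so it is an initial piece of some \<open>along R\<close>, and \<open>R\<close> can be continued by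
  choosing children forever.\<close>

lemma geodesically_complete_if_children:
  assumes ch: "\<And>x. x \<in> verts G \<Longrightarrow> \<exists>y. child G v x y"
  shows "geodesically_complete G v"
  unfolding geodesically_complete_def
proof (intro allI impI)
  fix t :: real and f
  assume t: "t > 0" and "isometric_embedding {0..t} G f \<and> f 0 = vpt v"
  then have f: "isometric_embedding {0..t} G f" "f 0 = vpt v" by auto
  have ft: "f t \<in> realization G" "gdist G (vpt v) (f t) = t"
    using isometric_embeddingD[OF f(1), of t] isometric_embeddingD(2)[OF f(1), of 0 t] f(2) t by auto
  obtain R0 N where R0: "geoseq G v R0 N" "t \<le> real N" "f t = along R0 t"
    using realization_along[OF ft(1)] ft(2) by metis
  obtain R where R: "\<And>M. geoseq G v R M" "\<And>i. i \<le> N \<Longrightarrow> R i = R0 i"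
    using geoseq_extend[OF ch R0(1)] by blast
  have ft': "f t = along R t" using along_cong[of N R R0 t] R(2) R0 t by simp
  have "along R s = f s" if "s \<in> {0..t}" for s
    by (rule along_unique[OF R(1)[of N] _ R0(2) f ft' that, symmetric]) (use t in simp)
  then show "\<exists>F. isometric_embedding {0..} G F \<and> (\<forall>s\<in>{0..t}. F s = f s)"
    using isometric_along_ray[OF root_connected R(1) root_vert] by blast
qed

text \<open>With children everywhere, each point lies on a ray from the root, so any radius serves;
  \<open>1\<close> is taken.\<close>

lemma pole_if_children:
  assumes ch: "\<And>x. x \<in> verts G \<Longrightarrow> \<exists>y. child G v x y"
  shows "pole G v"
  unfolding pole_def
proof (intro exI[of _ 1] conjI ballI)
  fix p assume p: "p \<in> realization G"
  define s where "s = gdist G (vpt v) p"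
  obtain R0 N where R0: "geoseq G v R0 N" "0 \<le> s" "s \<le> real N" "p = along R0 s"
    using realization_along[OF p] unfolding s_def by metis
  obtain R where R: "\<And>M. geoseq G v R M" "\<And>i. i \<le> N \<Longrightarrow> R i = R0 i"
    using geoseq_extend[OF ch R0(1)] by blast
  have "p = along R s" using along_cong[of N R R0 s] R(2) R0 by simp
  then have "gdist G p (along R s) < 1" using M.zero[OF p p] by simp
  moreover have "along R 0 = vpt v" using R(1)[of 0] along_nat[of R 0] by (simp add: geoseq_def)
  ultimately show "\<exists>F. isometric_embedding {0..} G F \<and> F 0 = vpt v \<and> (\<exists>s\<ge>0. gdist G p (F s) < 1)"
    using isometric_along_ray[OF root_connected R(1) root_vert] R0(2) by blast
qed simp

text \<open>An extension of the geodesic to \<open>x\<close> must leave \<open>x\<close> through a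
  child. The root is excluded because the definition only extends geodesics of positive
  length.\<close>

lemma child_if_geodesically_complete:
  assumes gc: "geodesically_complete G v" and x: "x \<in> verts G" "x \<noteq> v"
  shows "\<exists>y. child G v x y"
proof -
  define N where "N = hop G v x"
  have N: "N > 0" using hop_eq_0[OF root_connected root_vert x(1)] x(2) by (simp add: N_def)
  obtain R where R: "geoseq G v R N" "R N = x" using geoseq_exists[OF x(1)] unfolding N_def .
  have "along R 0 = vpt v" using R(1) along_nat[of R 0] by (simp add: geoseq_def)
  then obtain F where F: "isometric_embedding {0..} G F" "\<forall>s\<in>{0..real N}. F s = along R s"
    using gc isometric_along[OF root_connected R(1) root_vert] N
    unfolding geodesically_complete_def by (metis of_nat_0_less_iff)
  \<comment> \<open>Half an edge beyond \<open>x\<close>: the vertex of level \<open>N\<close> on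
    the path from the root to \<open>F s\<close> is then within distance 1 of
    \<open>x\<close>.\<close>
  define s where "s = real N + 1 / 2"
  have F0: "F 0 = vpt v" "F (real N) = vpt x" using F(2) R \<open>along R 0 = vpt v\<close> by auto
  have Fs: "F s \<in> realization G" "gdist G (vpt v) (F s) = s" "gdist G (vpt x) (F s) = 1 / 2"
    using isometric_embeddingD[OF F(1), of s] isometric_embeddingD(2)[OF F(1), of 0 s]
      isometric_embeddingD(2)[OF F(1), of "real N" s] F0 by (auto simp: s_def)
  obtain R1 N1 where R1: "geoseq G v R1 N1" "s \<le> real N1" "F s = along R1 s"
    using realization_along[OF Fs(1)] Fs(2) by metis
  have N1: "N < N1" using R1(2) by (simp add: s_def)
  have v1: "R1 N \<in> verts G" using geoseq_vert[OF root_connected R1(1) root_vert] N1 by simp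
  have "gdist G (along R1 (real N)) (along R1 s) = \<bar>real N - s\<bar>"
    using isometric_embeddingD(2)[OF isometric_along[OF root_connected R1(1) root_vert], of "real N" s] N1 R1(2)
    by (simp add: s_def del: along_nat)
  then have "gdist G (vpt (R1 N)) (F s) = 1 / 2" using R1(3) by (simp add: s_def)
  then have "gdist G (vpt x) (vpt (R1 N)) \<le> 1"
    using M.triangle[of "vpt x" "F s" "vpt (R1 N)"] M.commute[of "F s" "vpt (R1 N)"] Fs x v1
    by (simp add: vpt_realization)
  then have "hop G x (R1 N) \<le> 1" using gdist_vpt[OF root_connected x(1) v1] by simp
  \<comment> \<open>Both vertices have level \<open>N\<close>, and adjacent vertices of a tree lie
    on different levels.\<close>
  moreover have "hop G x (R1 N) \<noteq> 1"
    using hop_1[OF root_connected x(1) v1] hop_adj_neq[OF root_tree root_vert, of x "R1 N"]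
      geoseq_hop[OF root_connected R1(1), of N] N1 by (auto simp: N_def)
  ultimately have "hop G x (R1 N) = 0" by simp
  then have "x = R1 N" using hop_eq_0[OF root_connected x(1) v1] by simp
  then show ?thesis using R1(1) N1 by (auto simp: geoseq_def)
qed

text \<open>Lying on the geodesic means that distances add up, which
  \<open>descendant_iff_hop\<close> turns into descent.\<close>

lemma subtree_beyond_vpt:
  assumes a: "a \<in> verts G" and b: "b \<in> verts G"
  shows "vpt b \<in> subtree_beyond G v (vpt a) \<longleftrightarrow> (\<exists>k. (child G v ^^ k) a b)"
proof
  assume "vpt b \<in> subtree_beyond G v (vpt a)"
  then obtain f l s where f: "isometric_embedding {0..l} G f" "f 0 = vpt v" "f l = vpt b"
      "vpt a = f s" "s \<in> {0..l}"
    unfolding subtree_beyond_def geodesic_segment_def by auto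
  have d: "gdist G (f r) (f r') = \<bar>r - r'\<bar>" if "r \<in> {0..l}" "r' \<in> {0..l}" for r r'
    using isometric_embeddingD(2)[OF f(1) that] .
  have "gdist G (vpt v) (vpt b) = l" using d[of 0 l] f(5) unfolding f(2,3) by simp
  moreover have "gdist G (vpt v) (vpt a) = s" using d[of 0 s] f(5) unfolding f(2,4) by simp
  moreover have "gdist G (vpt a) (vpt b) = l - s" using d[of s l] f(5) unfolding f(3,4) by simp
  ultimately have "real (hop G v b) = l" "real (hop G v a) = s" "real (hop G a b) = l - s"
    by (simp_all add: gdist_vpt[OF root_connected] a b root_vert)
  then have "real (hop G v b) = real (hop G v a + hop G a b)" by simp
  then show "\<exists>k. (child G v ^^ k) a b"
    using descendant_iff_hop[OF root_tree root_vert a b] by (metis of_nat_eq_iff)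
next
  assume "\<exists>k. (child G v ^^ k) a b"
  then obtain k where k: "(child G v ^^ k) a b" ..
  define N where "N = hop G v b"
  obtain R where R: "geoseq G v R N" "R N = b" using geoseq_exists[OF b] unfolding N_def .
  have kN: "N = hop G v a + k" using hop_descendant[OF root_tree k] by (simp add: N_def)
  then have "a = R (N - k)" using geoseq_ancestor[OF R(1), of k a] R(2) k by simp
  then have "along R (real (N - k)) = vpt a" by simp
  then have "vpt a \<in> along R ` {0..real N}" by (metis atLeastAtMost_iff diff_le_self imageI of_nat_0_le_iff of_nat_le_iff)
  moreover have "along R 0 = vpt v" using R(1) along_nat[of R 0] by (simp add: geoseq_def)
  moreover have "along R (real N) = vpt b" using R(2) by simp
  ultimately have "vpt a \<in> geodesic_segment G (vpt v) (vpt b)"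
    using isometric_along[OF root_connected R(1) root_vert] of_nat_0_le_iff[of N]
    unfolding geodesic_segment_def by blast
  then show "vpt b \<in> subtree_beyond G v (vpt a)" by (simp add: subtree_beyond_def vpt_realization b)
qed

lemma sphere_pts_vpt: "sphere_pts G v k = vpt ` {x \<in> verts G. hop G v x = k}"
  using gdist_vpt[OF root_connected root_vert] by (auto simp: sphere_pts_def)

text \<open>Spheres become levels and subtrees beyond a vertex become descendants, which takes the
  realization out of the branching condition.\<close>

lemma K_pseudo_regular_iff:
  "K_pseudo_regular K G v \<longleftrightarrow> pole G v \<and>
    (\<forall>a\<in>verts G. \<exists>p q. p \<noteq> q \<and> (child G v ^^ K) a p \<and> (child G v ^^ K) a q)"
proof -
  have *: "vpt p \<in> sphere_pts G v (t + K) \<inter> subtree_beyond G v (vpt a) \<longleftrightarrow> (child G v ^^ K) a p"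
    if a: "a \<in> verts G" "hop G v a = t" for a p t
  proof
    assume "vpt p \<in> sphere_pts G v (t + K) \<inter> subtree_beyond G v (vpt a)"
    then have p: "p \<in> verts G" "hop G v p = t + K" and "vpt p \<in> subtree_beyond G v (vpt a)"
      by (auto simp: sphere_pts_vpt)
    then obtain k where k: "(child G v ^^ k) a p" using subtree_beyond_vpt a by blast
    then show "(child G v ^^ K) a p" using hop_descendant[OF root_tree k] p a by simp
  next
    assume k: "(child G v ^^ K) a p"
    then have "p \<in> verts G" using descendant_vert[OF root_tree a(1)] by blast
    then show "vpt p \<in> sphere_pts G v (t + K) \<inter> subtree_beyond G v (vpt a)"
      using subtree_beyond_vpt[OF a(1)] k a(2) hop_descendant[OF root_tree k] by (auto simp: sphere_pts_vpt)
  qed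
  have "(\<forall>t. \<forall>a\<in>sphere_pts G v t. \<exists>p q. p \<noteq> q \<and> {p, q} \<subseteq> sphere_pts G v (t + K) \<inter> subtree_beyond G v a) \<longleftrightarrow>
    (\<forall>a\<in>verts G. \<exists>p q. p \<noteq> q \<and> (child G v ^^ K) a p \<and> (child G v ^^ K) a q)" (is "?L \<longleftrightarrow> ?R")
  proof
    assume L: ?L
    show ?R
    proof
      fix a assume a: "a \<in> verts G"
      define t where "t = hop G v a"
      then have "vpt a \<in> sphere_pts G v t" using a by (auto simp: sphere_pts_vpt)
      then have "\<exists>p q. p \<noteq> q \<and> {p, q} \<subseteq> sphere_pts G v (t + K) \<inter> subtree_beyond G v (vpt a)"
        using L by simp
      then obtain p q where pq: "p \<noteq> q" "p \<in> sphere_pts G v (t + K) \<inter> subtree_beyond G v (vpt a)"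
          "q \<in> sphere_pts G v (t + K) \<inter> subtree_beyond G v (vpt a)"
        by (elim exE conjE) (simp only: insert_subset)
      obtain p' q' where p'q': "p = vpt p'" "q = vpt q'" using pq(2,3) by (auto simp: sphere_pts_vpt)
      show "\<exists>p q. p \<noteq> q \<and> (child G v ^^ K) a p \<and> (child G v ^^ K) a q"
      proof (intro exI conjI)
        show "p' \<noteq> q'" using pq(1) p'q' by simp
        show "(child G v ^^ K) a p'"
          using pq(2) unfolding p'q' by (rule *[OF a t_def[symmetric], THEN iffD1])
        show "(child G v ^^ K) a q'"
          using pq(3) unfolding p'q' by (rule *[OF a t_def[symmetric], THEN iffD1])
      qed
    qed
  next
    assume R: ?R
    show ?L
    proof (intro allI ballI)
      fix t x assume "x \<in> sphere_pts G v t"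
      then obtain a where a: "a \<in> verts G" "hop G v a = t" "x = vpt a" by (auto simp: sphere_pts_vpt)
      from R[THEN bspec, OF a(1)] obtain p q where "p \<noteq> q" "(child G v ^^ K) a p" "(child G v ^^ K) a q"
        by (elim exE conjE)
      then show "\<exists>p q. p \<noteq> q \<and> {p, q} \<subseteq> sphere_pts G v (t + K) \<inter> subtree_beyond G v x"
        using *[OF a(1,2)] a(3) by (intro exI[of _ "vpt p"] exI[of _ "vpt q"]) auto
    qed
  qed
  then show ?thesis by (simp add: K_pseudo_regular_def)
qed

end

section \<open>Isoperimetry\<close>

text \<open>Agrees with \<open>vertex_boundary\<close> for nonempty finite \<open>A\<close>. It is
  empty for \<open>A = {}\<close>, where the infimum in \<open>vertex_boundary\<close> runs over the
  empty set.\<close>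

definition bd :: "'a ugraph \<Rightarrow> 'a set \<Rightarrow> 'a set" where
  "bd G A = {w \<in> verts G - A. \<exists>a\<in>A. adj G a w}"

text \<open>For finite nonempty \<open>A\<close> the infimum is a minimum of natural
  numbers.\<close>

lemma vertex_boundary_eq_bd:
  assumes G: "connected_graph G" and A: "A \<noteq> {}" "finite A" "A \<subseteq> verts G"
  shows "vertex_boundary G A = bd G A"
proof -
  have "(INF a\<in>A. gdist G (vpt w) (vpt a)) = 1 \<longleftrightarrow> w \<notin> A \<and> (\<exists>a\<in>A. adj G a w)"
    if w: "w \<in> verts G" for w
  proof -
    have "(INF a\<in>A. gdist G (vpt w) (vpt a)) = (INF a\<in>A. real (hop G w a))"
      by (rule arg_cong[where f = Inf], rule image_cong) (use gdist_vpt[OF G w] A in auto)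
    also have "\<dots> = Min ((\<lambda>a. real (hop G w a)) ` A)"
      using A by (intro cInf_eq_Min) auto
    also have "\<dots> = 1 \<longleftrightarrow> (\<exists>a\<in>A. hop G w a = 1) \<and> (\<forall>a\<in>A. 1 \<le> hop G w a)"
      using A by (auto simp: Min_eq_iff)
    also have "\<dots> \<longleftrightarrow> w \<notin> A \<and> (\<exists>a\<in>A. adj G a w)"
    proof -
      have "1 \<le> hop G w a \<longleftrightarrow> w \<noteq> a" "hop G w a = 1 \<longleftrightarrow> adj G a w" if "a \<in> A" for a
        using hop_eq_0[OF G w, of a] hop_1[OF G w, of a] that A adj_sym[of G a w] by auto
      then show ?thesis by auto
    qed
    finally show ?thesis .
  qed
  then show ?thesis by (auto simp: vertex_boundary_def bd_def)
qed

lemma le_divide_of_nat_ennreal: "0 < n \<Longrightarrow> c \<le> x / of_nat n \<longleftrightarrow> c * of_nat n \<le> (x :: ennreal)"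
  using divide_less_ennreal[of "of_nat n" x c] by (auto simp: not_less[symmetric] of_nat_less_top)

text \<open>Isoperimetric form without division, through which lower bounds on
  \<open>cheeger\<close> are proved.\<close>

lemma le_cheeger_iff:
  assumes G: "connected_graph G"
  shows "c \<le> cheeger G \<longleftrightarrow>
    (\<forall>A. A \<noteq> {} \<and> finite A \<and> A \<subseteq> verts G \<longrightarrow> c * of_nat (card A) \<le> ecard (bd G A))"
proof -
  have "c \<le> ecard (vertex_boundary G A) / ecard A \<longleftrightarrow> c * of_nat (card A) \<le> ecard (bd G A)"
    if "A \<noteq> {}" "finite A" "A \<subseteq> verts G" for A
    using that vertex_boundary_eq_bd[OF G that] le_divide_of_nat_ennreal[of "card A"]
    by (simp add: ecard_def card_gt_0_iff)
  then show ?thesis by (auto simp: cheeger_def le_INF_iff)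
qed

lemma cheeger_mult_card_le:
  assumes "connected_graph G" "finite A" "A \<subseteq> verts G"
  shows "cheeger G * of_nat (card A) \<le> ecard (bd G A)"
  using le_cheeger_iff[OF assms(1), of "cheeger G"] assms(2,3) by (cases "A = {}") auto

lemma ecard_mono: "A \<subseteq> B \<Longrightarrow> ecard A \<le> ecard B"
  by (auto simp: ecard_def card_mono intro: finite_subset)

lemma ecard_le: "finite B \<Longrightarrow> A \<subseteq> B \<Longrightarrow> card B \<le> n \<Longrightarrow> ecard A \<le> of_nat n"
  using ecard_mono[of A B] by (auto simp: ecard_def intro: order_trans)

text \<open>For \<open>h\<close> the Cheeger constant, every set of \<open>N\<close> vertices has
  more than \<open>m\<close> boundary points; this contradicts a bound \<open>m\<close> on some
  boundary.\<close>

lemma ennreal_archimedean: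
  assumes "0 < (h :: ennreal)"
  obtains N :: nat where "0 < N" "of_nat m < h * of_nat N"
proof (cases "h = \<infinity>")
  case True
  then show thesis using that[of 1] by (simp add: of_nat_less_top)
next
  case False
  then obtain r where r: "h = ennreal r" "0 < r"
    using assms by (cases h) auto
  obtain N :: nat where N: "real m / r < N" using reals_Archimedean2 by blast
  then have "real m < r * N" using r by (simp add: field_simps)
  moreover have "0 < N" using N r by (cases N) (auto simp: not_less[symmetric] divide_less_0_iff)
  ultimately show thesis
    using that[of N] r by (simp add: ennreal_of_nat_eq_real_of_nat ennreal_mult[symmetric] ennreal_less_iff)
qed

lemma rtranclp_crossing:
  assumes "R\<^sup>*\<^sup>* x y" "P x" "\<not> P y"
  obtains p q where "R\<^sup>*\<^sup>* x p" "R p q" "P p" "\<not> P q"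
proof -
  have "R\<^sup>*\<^sup>* x y \<Longrightarrow> \<not> P y \<Longrightarrow> \<exists>p q. R\<^sup>*\<^sup>* x p \<and> R p q \<and> P p \<and> \<not> P q"
    by (induction rule: rtranclp_induct) (use assms(2) in blast)+
  then show thesis using that assms by blast
qed

text \<open>Each point of \<open>A\<close> has two chosen descendants at depth \<open>K\<close>, and all chosen points are
  distinct. At least \<open>card A\<close> of them lie outside \<open>A\<close>; on the way from \<open>a\<close> to such a point one
  crosses the boundary, and a boundary point determines \<open>a\<close> up to \<open>K\<close> choices.\<close>

lemma pseudo_regular_isoperimetry:
  assumes T: "rooted_tree G v" and A: "finite A" "A \<subseteq> verts G" and K: "K \<ge> 1"
    and pr: "\<And>a. a \<in> verts G \<Longrightarrow> \<exists>p q. p \<noteq> q \<and> (child G v ^^ K) a p \<and> (child G v ^^ K) a q"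
    and fin: "finite (bd G A)"
  shows "card A \<le> 2 * K * card (bd G A)"
proof -
  have tree: "tree G" and v: "v \<in> verts G" using T by (auto simp: rooted_tree_def)
  have "\<forall>a\<in>A. \<exists>p q. p \<noteq> q \<and> (child G v ^^ K) a p \<and> (child G v ^^ K) a q" using pr A by blast
  then obtain p q where pq: "\<And>a. a \<in> A \<Longrightarrow> p a \<noteq> q a" "\<And>a. a \<in> A \<Longrightarrow> (child G v ^^ K) a (p a)"
    "\<And>a. a \<in> A \<Longrightarrow> (child G v ^^ K) a (q a)" by metis
  note uniq = ancestor_unique[OF tree v]
  have "inj_on p A" "inj_on q A" by (auto intro!: inj_onI dest: pq uniq) (metis pq(2) uniq, metis pq(3) uniq)
  moreover have "p ` A \<inter> q ` A = {}" using pq uniq by (auto, metis)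
  ultimately have "card (p ` A \<union> q ` A) = 2 * card A"
    using A by (simp add: card_Un_disjoint card_image)
  moreover have "card (p ` A \<union> q ` A) \<le> card ((p ` A \<union> q ` A) - A) + card A"
    using card_mono[of "((p ` A \<union> q ` A) - A) \<union> A" "p ` A \<union> q ` A"] A
      card_Un_le[of "(p ` A \<union> q ` A) - A" A] by (simp add: subset_eq)
  ultimately have 1: "card A \<le> card ((p ` A \<union> q ` A) - A)" by simp
  \<comment> \<open>\<open>THE\<close> is arbitrary where \<open>z\<close> has no ancestor
    \<open>m\<close> levels up. Stray points only enlarge \<open>?Z\<close>, which still has at most
    \<open>2 * K\<close> points for each \<open>z\<close>.\<close>
  define anc where "anc m z = (THE a. (child G v ^^ m) a z)" for m z
  have anc: "anc m z = a" if "(child G v ^^ m) a z" for m z a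
    unfolding anc_def using that uniq by blast
  let ?Z = "\<Union>z\<in>bd G A. \<Union>m\<in>{1..K}. {p (anc m z), q (anc m z)}"
  have "x \<in> ?Z" if a: "a \<in> A" and x: "x = p a \<or> x = q a" "x \<notin> A" for a x
  proof -
    have "(child G v ^^ K) a x" using pq a x by auto
    then obtain f where f: "f 0 = a" "f K = x" "\<And>i. i < K \<Longrightarrow> child G v (f i) (f (Suc i))"
      unfolding relpowp_fun_conv by blast
    \<comment> \<open>First exit from \<open>A\<close>; it happens between 1 and \<open>K\<close>
      since the path starts in \<open>A\<close> and ends outside.\<close>
    define m where "m = (LEAST m. f m \<notin> A)"
    have "f K \<notin> A" using f(2) x(2) by simp
    then have m: "f m \<notin> A" "m \<le> K" unfolding m_def by (rule LeastI, rule Least_le)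
    have m0: "m \<noteq> 0" using m f(1) a by metis
    then have m1: "f (m - 1) \<in> A" using not_less_Least[of "m - 1" "\<lambda>m. f m \<notin> A"] by (simp add: m_def)
    have ch: "child G v (f (m - 1)) (f m)" using f(3)[of "m - 1"] m m0 by simp
    then have "f m \<in> bd G A"
      using m(1) m1 childD[OF connected_if_tree[OF tree] ch] by (auto simp: bd_def)
    moreover have "(child G v ^^ m) a (f m)"
      unfolding relpowp_fun_conv using f m by (intro exI[of _ f]) auto
    then have "anc m (f m) = a" by (rule anc)
    ultimately show ?thesis using x(1) m m0 by force
  qed
  then have "(p ` A \<union> q ` A) - A \<subseteq> ?Z" by blast
  then have 2: "card ((p ` A \<union> q ` A) - A) \<le> card ?Z" using fin by (intro card_mono) auto
  have "card ?Z \<le> (\<Sum>z\<in>bd G A. card (\<Union>m\<in>{1..K}. {p (anc m z), q (anc m z)}))"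
    by (rule card_UN_le[OF fin])
  also have "\<dots> \<le> (\<Sum>z\<in>bd G A. 2 * K)"
  proof (rule sum_mono)
    fix z
    have "card (\<Union>m\<in>{1..K}. {p (anc m z), q (anc m z)}) \<le> (\<Sum>m\<in>{1..K}. card {p (anc m z), q (anc m z)})"
      by (rule card_UN_le) simp
    also have "\<dots> \<le> (\<Sum>m\<in>{1..K}. 2)" by (rule sum_mono) (simp add: card_insert_if)
    finally show "card (\<Union>m\<in>{1..K}. {p (anc m z), q (anc m z)}) \<le> 2 * K" by simp
  qed
  finally show ?thesis using 1 2 by (simp add: mult.commute)
qed

text \<open>A long stretch without branching has at most two boundary points.\<close>

lemma pseudo_regular_if_cheeger_pos:
  assumes T: "rooted_tree G v" and ch: "\<And>x. x \<in> verts G \<Longrightarrow> \<exists>y. child G v x y"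
    and h: "0 < cheeger G"
  shows "pseudo_regular G v"
proof -
  have tree: "tree G" and v: "v \<in> verts G" using T by (auto simp: rooted_tree_def)
  note con = connected_if_tree[OF tree]
  \<comment> \<open>\<open>N\<close> exceeds the length of any stretch with at most two boundary
    points, and it also serves as the constant of pseudo-regularity.\<close>
  obtain N where N: "0 < N" "of_nat 2 < cheeger G * of_nat N" using ennreal_archimedean[OF h] .
  have "\<exists>p q. p \<noteq> q \<and> (child G v ^^ N) a p \<and> (child G v ^^ N) a q" if a: "a \<in> verts G" for a
  proof (rule ccontr)
    assume no: "\<not> ?thesis"
    define c where "c x = (SOME y. child G v x y)" for x
    have c: "child G v x (c x)" if "x \<in> verts G" for x
      unfolding c_def by (rule someI_ex[OF ch[OF that]])
    have down: "(child G v ^^ k) x ((c ^^ k) x) \<and> (c ^^ k) x \<in> verts G" if "x \<in> verts G" for k x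
      by (induction k) (use that c childD(2)[OF con c] in auto)
    define R where "R i = (c ^^ i) a" for i
    have R: "(child G v ^^ i) a (R i)" "R i \<in> verts G" "child G v (R i) (R (Suc i))" for i
      using down[OF a, of i] c by (auto simp: R_def)
    \<comment> \<open>A second child before depth \<open>N\<close> would, by following chosen
      children from both, yield two distinct descendants of \<open>a\<close> at depth
      \<open>N\<close>.\<close>
    have only: "y = R (Suc i)" if i: "i < N" and y: "child G v (R i) y" for i y
    proof (rule ccontr)
      assume ne: "y \<noteq> R (Suc i)"
      define k where "k = N - Suc i"
      have Nk: "N = Suc i + k" using i by (simp add: k_def)
      have yv: "y \<in> verts G" using childD(2)[OF con y] .
      have "(child G v ^^ Suc i) a y" using R(1)[of i] y by (rule relpowp_Suc_I)
      then have "(child G v ^^ N) a ((c ^^ k) y)" "(child G v ^^ N) a ((c ^^ k) (R (Suc i)))"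
        unfolding Nk using down[OF yv, of k] down[OF R(2), of k "Suc i"] R(1)[of "Suc i"]
        by (blast intro: relpowp_trans)+
      moreover have "(c ^^ k) y \<noteq> (c ^^ k) (R (Suc i))"
        using ancestor_unique[OF tree v] down[OF yv, of k] down[OF R(2), of k "Suc i"] ne by metis
      ultimately show False using no by blast
    qed
    define A where "A = R ` {..<N}"
    have hopR: "hop G v (R i) = hop G v a + i" for i using hop_descendant[OF tree R(1)] .
    then have "inj_on R {..<N}" by (auto intro!: inj_onI) (metis add_left_cancel)
    then have cA: "card A = N" by (simp add: A_def card_image)
    \<comment> \<open>The boundary of the stretch consists of its continuation \<open>R N\<close>
      and the parent of \<open>a\<close>, if there is one; for the root \<open>P\<close> is empty
      and \<open>z\<close> is arbitrary.\<close>
    define P where "P = {y. child G v y a}"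
    obtain z where z: "P \<subseteq> {z}"
    proof (cases "P = {}")
      case False
      then obtain z where "child G v z a" by (auto simp: P_def)
      then show thesis using that[of z] parent_unique[OF tree v] by (auto simp: P_def)
    qed (use that in simp)
    have "bd G A \<subseteq> {R N, z}"
    proof
      fix y assume "y \<in> bd G A"
      then obtain i where i: "i < N" "adj G (R i) y" "y \<notin> A" by (auto simp: bd_def A_def)
      show "y \<in> {R N, z}"
      proof (rule child_cases[OF tree v i(2)])
        assume "child G v (R i) y"
        then have "y = R (Suc i)" using only i by blast
        then show ?thesis using i by (auto simp: A_def) (metis Suc_lessI image_eqI lessThan_iff)
      next
        assume y: "child G v y (R i)"
        show ?thesis
        proof (cases i)
          case 0
          then show ?thesis using y z by (auto simp: P_def R_def)
        next
          case (Suc j)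
          then have "y = R j" using parent_unique[OF tree v y] R(3)[of j] by simp
          then show ?thesis using i Suc by (auto simp: A_def)
        qed
      qed
    qed
    then have "ecard (bd G A) \<le> of_nat 2" by (rule ecard_le[rotated]) (auto simp: card_insert_if)
    moreover have "cheeger G * of_nat N \<le> ecard (bd G A)"
      using cheeger_mult_card_le[OF con, of A] R(2) cA by (auto simp: A_def)
    ultimately show False using N(2) by (meson leD order_trans)
  qed
  then have "K_pseudo_regular N G v" 
    unfolding K_pseudo_regular_iff[OF T] by (intro conjI ballI pole_if_children[OF T ch])
  then show ?thesis by (auto simp: pseudo_regular_def)
qed

lemma cheeger_lower_ennreal:
  assumes "C \<ge> 1" "0 \<le> r"
  shows "cheeger_lower C (ennreal r) = ennreal (r / (real C + real (C - 1) * r))"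
proof -
  define d where "d = real C + real (C - 1) * r"
  have "d > 0" using assms by (simp add: d_def add_pos_nonneg)
  moreover have "of_nat C + of_nat (C - 1) * ennreal r = ennreal d"
    using assms(2) by (simp add: d_def ennreal_of_nat_eq_real_of_nat ennreal_mult[symmetric] del: of_nat_diff)
  ultimately show ?thesis
    unfolding d_def[symmetric] using assms(2) by (simp add: cheeger_lower_def divide_ennreal)
qed

section \<open>Subtrees with the same root and the blocks hanging off them\<close>

text \<open>By \<open>child_sub\<close> these are the edges of \<open>T\<close> outside
  \<open>S\<close>, directed away from the root.\<close>

definition off :: "'a ugraph \<Rightarrow> 'a \<Rightarrow> 'a ugraph \<Rightarrow> 'a \<Rightarrow> 'a \<Rightarrow> bool" where
  "off T v S y x \<longleftrightarrow> child T v y x \<and> x \<notin> verts S"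

definition block :: "'a ugraph \<Rightarrow> 'a \<Rightarrow> 'a ugraph \<Rightarrow> 'a \<Rightarrow> 'a set" where
  "block T v S w = {x. (off T v S)\<^sup>*\<^sup>* w x}"

text \<open>Retraction of the vertices of \<open>T\<close> onto those of \<open>S\<close>, whose
  fibres are the blocks (\<open>block_eq\<close>).\<close>

definition ret :: "'a ugraph \<Rightarrow> 'a \<Rightarrow> 'a ugraph \<Rightarrow> 'a \<Rightarrow> 'a" where
  "ret T v S x = (SOME w. w \<in> verts S \<and> (off T v S)\<^sup>*\<^sup>* w x)"

context
  fixes T S :: "'a ugraph" and v :: 'a
  assumes T: "rooted_tree T v" and S: "rooted_tree S v" and sub: "subgraph_of S T"
begin

lemma treeT: "tree T" and treeS: "tree S" and rootT: "v \<in> verts T" and rootS: "v \<in> verts S"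
  and connT: "connected_graph T" and connS: "connected_graph S" and simpleT: "simple_graph T"
  and simpleS: "simple_graph S"
  using T S by (auto simp: rooted_tree_def tree_def connected_graph_def)

lemma sub_vert: "x \<in> verts S \<Longrightarrow> x \<in> verts T"
  using sub by (auto simp: subgraph_of_def)

lemma sub_adj: "adj S x y \<Longrightarrow> adj T x y"
  using sub by (auto simp: subgraph_of_def adj_def)

text \<open>Induction on the level in \<open>S\<close>. If the parent \<open>y\<close> of
  \<open>x\<close> in \<open>S\<close> were a child of \<open>x\<close> in \<open>T\<close>, the
  parent of \<open>y\<close> in \<open>S\<close> would by induction also be its parent in
  \<open>T\<close>, hence equal \<open>x\<close>, against the levels in \<open>S\<close>.\<close>

lemma hop_sub: "x \<in> verts S \<Longrightarrow> hop S v x = hop T v x"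
proof (induction "hop S v x" arbitrary: x rule: less_induct)
  case less
  show ?case
  proof (cases "x = v")
    case False
    then obtain y where y: "child S v y x" using child_exists[OF connS rootS less.prems] by metis
    note yD = childD[OF connS y]
    have hy: "hop S v y = hop T v y" using less.hyps[of y] yD by simp
    have aT: "adj T y x" using sub_adj yD by blast
    show ?thesis
    proof (rule child_cases[OF treeT rootT aT])
      assume "child T v y x"
      then show ?thesis using childD(4)[OF connT] yD hy by metis
    next
      assume xy: "child T v x y"
      then have "y \<noteq> v" using childD(4)[OF connT xy] by auto
      then obtain z where z: "child S v z y" using child_exists[OF connS rootS yD(1)] by metis
      note zD = childD[OF connS z]
      have "hop S v z = hop T v z" using less.hyps[of z] zD yD by simp
      then have "child T v z y" using hy zD sub_adj by (simp add: child_def)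
      then have "z = x" using parent_unique[OF treeT rootT] xy by blast
      then show ?thesis using zD yD by simp
    qed
  qed simp
qed

text \<open>Levels agree, and the parent of \<open>x\<close> in \<open>S\<close> is its only parent
  in \<open>T\<close>. In particular a downward edge of \<open>T\<close> ending in \<open>S\<close>
  is an edge of \<open>S\<close>.\<close>

lemma child_sub: "child S v y x \<longleftrightarrow> child T v y x \<and> x \<in> verts S"
proof
  assume y: "child S v y x"
  note yD = childD[OF connS y]
  then show "child T v y x \<and> x \<in> verts S"
    using hop_sub[of x] hop_sub[of y] sub_adj by (simp add: child_def)
next
  assume y: "child T v y x \<and> x \<in> verts S"
  then have "x \<noteq> v" using childD(4)[OF connT, of v y x] by auto
  then obtain z where z: "child S v z x" using child_exists[OF connS rootS, of x] y by metis
  note zD = childD[OF connS z]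
  have "child T v z x" using zD hop_sub[of x] hop_sub[of z] sub_adj by (simp add: child_def)
  then show "child S v y x" using parent_unique[OF treeT rootT] y z by metis
qed

lemma off_reach_vert: "(off T v S)\<^sup>*\<^sup>* w x \<Longrightarrow> w \<in> verts T \<Longrightarrow> x \<in> verts T"
  by (induction rule: rtranclp_induct) (auto simp: off_def dest: childD[OF connT])

lemma off_reach_exists:
  "x \<in> verts T \<Longrightarrow> \<exists>w. w \<in> verts S \<and> (off T v S)\<^sup>*\<^sup>* w x"
proof (induction "hop T v x" arbitrary: x rule: less_induct)
  case less
  show ?case
  proof (cases "x \<in> verts S")
    case False
    then have "x \<noteq> v" using rootS by auto
    then obtain y where y: "child T v y x" using child_exists[OF connT rootT less.prems] by metis
    then obtain w where "w \<in> verts S" "(off T v S)\<^sup>*\<^sup>* w y"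
      using less.hyps[of y] childD[OF connT y] by auto
    moreover have "off T v S y x" using y False by (simp add: off_def)
    ultimately show ?thesis by (meson rtranclp.rtrancl_into_rtrancl)
  qed blast
qed

text \<open>Going up is forced by uniqueness of parents, and it stops at the first vertex of
  \<open>S\<close>, since no \<open>off\<close> step ends in \<open>S\<close>.\<close>

lemma off_reach_unique:
  assumes "(off T v S)\<^sup>*\<^sup>* w x" "(off T v S)\<^sup>*\<^sup>* w' x" "w \<in> verts S" "w' \<in> verts S"
  shows "w = w'"
  using assms(1,2)
proof (induction rule: rtranclp_induct)
  case base
  then show ?case using assms(3) by (cases rule: rtranclp.cases) (auto simp: off_def)
next
  case (step y x)
  from step.prems have "(off T v S)\<^sup>*\<^sup>* w' y"
  proof (cases rule: rtranclp.cases)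
    case rtrancl_refl
    then show ?thesis using step.hyps(2) assms(4) by (simp add: off_def)
  next
    case (rtrancl_into_rtrancl z)
    then have "z = y" using step.hyps(2) parent_unique[OF treeT rootT, of z x y] by (simp add: off_def)
    then show ?thesis using rtrancl_into_rtrancl by simp
  qed
  then show ?case by (rule step.IH)
qed

lemma ret_eqI: "w \<in> verts S \<Longrightarrow> (off T v S)\<^sup>*\<^sup>* w x \<Longrightarrow> ret T v S x = w"
  unfolding ret_def by (rule some_equality) (use off_reach_unique in blast)+

lemma ret:
  assumes "x \<in> verts T"
  shows "ret T v S x \<in> verts S" "(off T v S)\<^sup>*\<^sup>* (ret T v S x) x"
  using someI_ex[OF off_reach_exists[OF assms]] by (auto simp: ret_def)

lemma ret_sub [simp]: "w \<in> verts S \<Longrightarrow> ret T v S w = w"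
  by (rule ret_eqI) auto

lemma block_eq: "w \<in> verts S \<Longrightarrow> block T v S w = {x \<in> verts T. ret T v S x = w}"
  using ret_eqI ret off_reach_vert sub_vert by (auto simp: block_def)

lemma ret_off:
  assumes "off T v S y x"
  shows "ret T v S x = ret T v S y"
proof -
  have y: "y \<in> verts T" using assms childD(1)[OF connT] by (auto simp: off_def)
  have "(off T v S)\<^sup>*\<^sup>* (ret T v S y) x" using ret(2)[OF y] assms by (rule rtranclp.rtrancl_into_rtrancl)
  then show ?thesis by (rule ret_eqI[OF ret(1)[OF y]])
qed

text \<open>Different blocks are joined only by edges of \<open>S\<close>.\<close>

lemma adj_ret: "adj T a b \<Longrightarrow> adj S a b \<or> ret T v S a = ret T v S b"
proof -
  have *: "adj S a b \<or> ret T v S a = ret T v S b" if "child T v a b" for a b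
    using ret_off[of a b] child_sub[of a b] that by (auto simp: off_def child_def)
  assume ab: "adj T a b"
  show ?thesis
    by (rule child_cases[OF treeT rootT ab]) (use * adj_sym in metis)+
qed

lemma ret_neq_imp_sub:
  assumes "adj T a b" "ret T v S a \<noteq> ret T v S b"
  shows "adj S a b" "a \<in> verts S" "b \<in> verts S"
  using adj_ret[OF assms(1)] assms(2) adjD[OF simpleS, of a b] by auto

section \<open>Comparison of Cheeger constants\<close>

text \<open>Replacing \<open>A\<close> by the union \<open>B\<close> of the blocks over it does not
  decrease the size, and an edge leaving \<open>B\<close> changes the block, so it is an edge of
  \<open>S\<close> leaving \<open>A\<close>. Finiteness of the blocks makes \<open>B\<close> a
  competitor in \<open>T\<close>.\<close>

lemma cheeger_le_sub:
  assumes fin: "\<And>w. w \<in> verts S \<Longrightarrow> finite (block T v S w)"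
  shows "cheeger T \<le> cheeger S"
  unfolding le_cheeger_iff[OF connS]
proof (intro allI impI)
  fix A assume A: "A \<noteq> {} \<and> finite A \<and> A \<subseteq> verts S"
  define B where "B = (\<Union>w\<in>A. block T v S w)"
  have fB: "finite B" using fin A by (auto simp: B_def)
  have BT: "B \<subseteq> verts T" using block_eq A by (auto simp: B_def)
  have AB: "A \<subseteq> B" by (auto simp: B_def block_def)
  have inB: "x \<in> B \<longleftrightarrow> x \<in> verts T \<and> ret T v S x \<in> A" for x using block_eq A by (auto simp: B_def)
  have "bd T B \<subseteq> bd S A"
  proof
    fix x assume "x \<in> bd T B"
    then obtain a where a: "x \<in> verts T" "x \<notin> B" "a \<in> B" "adj T a x" by (auto simp: bd_def)
    then have "ret T v S a \<noteq> ret T v S x" using inB[of a] inB[of x] by metis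
    note * = ret_neq_imp_sub[OF a(4) this]
    then have "a \<in> A" using a(3) inB[of a] ret_sub[OF *(2)] by simp
    then show "x \<in> bd S A" using * a(2) AB by (auto simp: bd_def)
  qed
  have "cheeger T * of_nat (card A) \<le> cheeger T * of_nat (card B)"
    using card_mono[OF fB AB] by (intro mult_left_mono) auto
  also have "\<dots> \<le> ecard (bd T B)" by (rule cheeger_mult_card_le[OF connT fB BT])
  also have "\<dots> \<le> ecard (bd S A)" by (rule ecard_mono) fact
  finally show "cheeger T * of_nat (card A) \<le> ecard (bd S A)" .
qed

text \<open>All of the block is reached from \<open>w\<close> by \<open>off\<close> steps. If
  \<open>w\<close> is in \<open>A\<close>, the walk to \<open>b\<close> leaves \<open>A\<close>;
  otherwise the walk to \<open>a\<close> enters it. The outer vertex at the crossing is a boundary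
  point.\<close>

lemma block_boundary:
  assumes w: "w \<in> verts S" and "block T v S w \<inter> A \<noteq> {}" "\<not> block T v S w \<subseteq> A"
  shows "\<exists>x\<in>block T v S w. x \<in> bd T A"
proof -
  obtain a b where ab: "a \<in> block T v S w" "a \<in> A" "b \<in> block T v S w" "b \<notin> A"
    using assms by blast
  show ?thesis
  proof (cases "w \<in> A")
    case True
    obtain p q where pq: "(off T v S)\<^sup>*\<^sup>* w p" "off T v S p q" "p \<in> A" "\<not> q \<in> A"
      using rtranclp_crossing[of "off T v S" w b "\<lambda>x. x \<in> A"] ab True by (auto simp: block_def)
    then have "q \<in> bd T A" using childD[OF connT, of v p q] by (auto simp: bd_def off_def)
    moreover have "(off T v S)\<^sup>*\<^sup>* w q" using pq by (meson rtranclp.rtrancl_into_rtrancl)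
    ultimately show ?thesis by (auto simp: block_def)
  next
    case False
    obtain p q where pq: "(off T v S)\<^sup>*\<^sup>* w p" "off T v S p q" "\<not> p \<in> A" "\<not> \<not> q \<in> A"
      using rtranclp_crossing[of "off T v S" w a "\<lambda>x. x \<notin> A"] ab False by (auto simp: block_def)
    then have "p \<in> bd T A" using childD[OF connT, of v p q] adj_sym[of T p q] by (auto simp: bd_def off_def)
    then show ?thesis using pq by (auto simp: block_def)
  qed
qed

text \<open>Blocks contained in \<open>A\<close> are controlled by the boundary in \<open>S\<close>; every other block that meets
  \<open>A\<close> contains a boundary point itself.\<close>

lemma full_and_partial_blocks:
  assumes A: "finite A" "A \<subseteq> verts T" and fin: "finite (bd T A)"
    and C: "\<And>w. w \<in> verts S \<Longrightarrow> finite (block T v S w) \<and> card (block T v S w) \<le> C"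
  obtains F q where "finite F" "F \<subseteq> verts S" "finite (bd S F)" "card (bd S F) \<le> card (bd T A)"
    "q \<le> card (bd T A)" "card A \<le> C * card F + (C - 1) * q"
proof -
  let ?r = "ret T v S" and ?B = "block T v S"
  define F where "F = {w \<in> ?r ` A. ?B w \<subseteq> A}"
  define Q where "Q = ?r ` A - F"
  have PS: "?r ` A \<subseteq> verts S" using ret(1) A by auto
  have fFQ: "finite F" "finite Q" using A by (auto simp: F_def Q_def)
  have inter: "?B w \<inter> A \<noteq> {}" if wP: "w \<in> ?r ` A" for w
  proof -
    obtain a where a: "a \<in> A" "w = ?r a" using wP by blast
    then have "a \<in> ?B w" using ret(2)[of a] A by (auto simp: block_def)
    then show ?thesis using a by blast
  qed
  have Q: "\<exists>x\<in>?B w. x \<in> bd T A" if "w \<in> Q" for w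
    using block_boundary[of w A] inter[of w] that PS by (auto simp: Q_def F_def)
  \<comment> \<open>The retraction maps \<open>bd T A\<close> onto a set containing
    \<open>bd S F\<close> and \<open>Q\<close>. A vertex of \<open>bd S F\<close> outside
    \<open>Q\<close> is not in \<open>A\<close>, since its block would then belong to
    \<open>F\<close> or \<open>Q\<close>; so it is itself in \<open>bd T A\<close> and is fixed by
    the retraction.\<close>
  have "x \<in> ?r ` bd T A" if x: "x \<in> bd S F \<union> Q" for x
  proof (cases "x \<in> Q")
    case True
    then obtain y where "y \<in> ?B x" "y \<in> bd T A" using Q by blast
    moreover have "x \<in> verts S" using True PS by (auto simp: Q_def)
    ultimately have "?r y = x" using block_eq by blast
    then show ?thesis using \<open>y \<in> bd T A\<close> by blast
  next
    case False
    then obtain w where w: "w \<in> F" "adj S w x" "x \<in> verts S" "x \<notin> F" using x by (auto simp: bd_def)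
    have "x \<notin> A"
    proof
      assume "x \<in> A"
      then have "x \<in> ?r ` A" using w(3) ret_sub by (metis imageI)
      then show False using w(4) False by (simp add: Q_def)
    qed
    moreover have "w \<in> A" using w(1) by (auto simp: F_def block_def)
    ultimately have "x \<in> bd T A" using w sub_adj sub_vert by (auto simp: bd_def)
    then show ?thesis using w(3) ret_sub by (metis imageI)
  qed
  then have sb: "bd S F \<union> Q \<subseteq> ?r ` bd T A" by blast
  have le: "card X \<le> card (bd T A)" if "X \<subseteq> bd S F \<union> Q" for X
    using card_mono[OF finite_imageI[OF fin], OF subset_trans[OF that sb]] card_image_le[OF fin, of ?r]
    by (rule le_trans)
  have fbd: "finite (bd S F)" using sb fin by (meson Un_subset_iff finite_imageI finite_subset)
  have "A \<subseteq> (\<Union>w\<in>F. ?B w) \<union> (\<Union>w\<in>Q. ?B w \<inter> A)"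
  proof
    fix a assume a: "a \<in> A"
    then have "a \<in> ?B (?r a)" using ret(2)[of a] A by (auto simp: block_def)
    then show "a \<in> (\<Union>w\<in>F. ?B w) \<union> (\<Union>w\<in>Q. ?B w \<inter> A)" using a by (auto simp: Q_def)
  qed
  then have "card A \<le> card ((\<Union>w\<in>F. ?B w) \<union> (\<Union>w\<in>Q. ?B w \<inter> A))"
    by (rule card_mono[rotated]) (rule finite_subset[OF _ A(1)], auto simp: F_def)
  also have "\<dots> \<le> card (\<Union>w\<in>F. ?B w) + card (\<Union>w\<in>Q. ?B w \<inter> A)" by (rule card_Un_le)
  also have "\<dots> \<le> (\<Sum>w\<in>F. card (?B w)) + (\<Sum>w\<in>Q. card (?B w \<inter> A))"
    using fFQ by (intro add_mono card_UN_le)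
  also have "\<dots> \<le> (\<Sum>w\<in>F. C) + (\<Sum>w\<in>Q. C - 1)"
  proof (intro add_mono sum_mono)
    fix w assume "w \<in> F"
    then show "card (?B w) \<le> C" using C PS by (auto simp: F_def)
  next
    \<comment> \<open>A block in \<open>Q\<close> is not contained in \<open>A\<close>, so it
      contributes at least one vertex less than its size; hence \<open>C - 1\<close>.\<close>
    fix w assume w: "w \<in> Q"
    then have "w \<in> verts S" "?B w \<inter> A \<subset> ?B w" using PS by (auto simp: F_def Q_def)
    then have "card (?B w \<inter> A) < card (?B w)" "card (?B w) \<le> C" using C psubset_card_mono by blast+
    then show "card (?B w \<inter> A) \<le> C - 1" by simp
  qed
  finally have "card A \<le> C * card F + (C - 1) * card Q" by (simp add: mult.commute)
  then show thesis using that[of F "card Q"] le[of "bd S F"] le[of Q] fFQ PS fbd by (auto simp: F_def)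
qed

text \<open>With \<open>h = cheeger S\<close> finite, \<open>h * card F \<le> \<beta>\<close> and
  \<open>q \<le> \<beta>\<close> combine to
  \<open>h * card A \<le> (C + (C - 1) * h) * \<beta>\<close>. An infinite boundary leaves nothing
  to prove.\<close>

lemma cheeger_lower_le:
  assumes C: "\<And>w. w \<in> verts S \<Longrightarrow> finite (block T v S w) \<and> card (block T v S w) \<le> C" and C1: "C \<ge> 1"
  shows "cheeger_lower C (cheeger S) \<le> cheeger T"
  unfolding le_cheeger_iff[OF connT]
proof (intro allI impI)
  fix A assume A: "A \<noteq> {} \<and> finite A \<and> A \<subseteq> verts T"
  show "cheeger_lower C (cheeger S) * of_nat (card A) \<le> ecard (bd T A)"
  proof (cases "finite (bd T A)")
    case fin: True
    define \<beta> where "\<beta> = card (bd T A)"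
    obtain F q where F: "finite F" "F \<subseteq> verts S" "finite (bd S F)" "card (bd S F) \<le> \<beta>"
      "q \<le> \<beta>" "card A \<le> C * card F + (C - 1) * q"
      using full_and_partial_blocks[of A C] A fin C unfolding \<beta>_def by metis
    have A0: "card A > 0" using A by (simp add: card_gt_0_iff)
    have eb: "ecard (bd T A) = of_nat \<beta>" using fin by (simp add: ecard_def \<beta>_def)
    have hF: "cheeger S * of_nat (card F) \<le> of_nat \<beta>"
      using cheeger_mult_card_le[OF connS F(1,2)] F(3,4) by (simp add: ecard_def) (meson of_nat_mono order_trans)
    show ?thesis
    proof (cases "cheeger S = \<infinity>")
      case True
      \<comment> \<open>Infinite \<open>cheeger S\<close> rules out full blocks, which leaves
        \<open>card A \<le> (C - 1) * \<beta>\<close> and matches the value of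
        \<open>cheeger_lower\<close> at infinity.\<close>
      have "card F = 0"
      proof (rule ccontr)
        assume "card F \<noteq> 0"
        then have "cheeger S * of_nat (card F) = \<infinity>" using True by (simp add: ennreal_top_mult)
        then show False using hF by (simp add: top_unique)
      qed
      then have AC: "card A \<le> (C - 1) * \<beta>" using F(5,6) by (metis add_0 le_trans mult_0_right mult_le_mono2)
      then have "C - 1 > 0" using A0 by (cases "C - 1") auto
      have "1 / of_nat (C - 1) * of_nat (card A) \<le> (1 / of_nat (C - 1) * of_nat ((C - 1) * \<beta>) :: ennreal)"
        using of_nat_mono[OF AC] by (rule mult_left_mono) simp
      also have "\<dots> = of_nat \<beta>"
        using \<open>C - 1 > 0\<close> by (simp add: ennreal_times_divide mult.assoc[symmetric] ennreal_divide_times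
            ennreal_divide_self of_nat_less_top)
      finally show ?thesis using True eb by (simp add: cheeger_lower_def)
    next
      case False
      then obtain r where r: "cheeger S = ennreal r" "0 \<le> r" by (cases "cheeger S") auto
      have rF: "r * card F \<le> \<beta>"
        using hF r by (simp add: ennreal_of_nat_eq_real_of_nat ennreal_mult[symmetric])
      define d where "d = real C + real (C - 1) * r"
      have d: "d > 0" using C1 r by (simp add: d_def add_pos_nonneg)
      have "real (card A) \<le> C * card F + (C - 1) * real q"
        using F(6) by (metis of_nat_add of_nat_le_iff of_nat_mult)
      then have "r * card A \<le> r * (C * card F + (C - 1) * real q)" using r(2) by (rule mult_left_mono)
      also have "\<dots> = C * (r * card F) + (C - 1) * r * q" by (simp add: algebra_simps)
      also have "\<dots> \<le> C * real \<beta> + (C - 1) * r * \<beta>"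
        by (rule add_mono[OF mult_left_mono[OF rF] mult_left_mono]) (use F(5) r(2) in auto)
      finally have "r * card A \<le> d * \<beta>" by (simp add: d_def algebra_simps)
      then have "r / d * card A \<le> \<beta>" using d by (simp add: field_simps)
      moreover have "cheeger_lower C (cheeger S) = ennreal (r / d)"
        using cheeger_lower_ennreal[OF C1 r(2)] r(1) by (simp add: d_def)
      ultimately show ?thesis
        using eb d r(2) by (simp add: ennreal_of_nat_eq_real_of_nat ennreal_mult[symmetric] ennreal_leI)
    qed
  qed (simp add: ecard_def)
qed

section \<open>Blocks and the components of the closed complement\<close>

text \<open>Points of the realization of \<open>S\<close> have coordinate 0 at \<open>b\<close>, so
  the edge without \<open>a\<close> lies outside it; \<open>a\<close> is a limit point of the
  rest.\<close>

lemma off_edge_closed: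
  assumes "off T v S a b"
  shows "closed_edge {a, b} \<subseteq> gtop T closure_of (realization T - realization S)"
proof -
  interpret M: Metric_space "realization T" "gdist T" by (rule Metric_space_gdist[OF connT])
  have ab: "adj T a b" "b \<notin> verts S" using assms by (auto simp: off_def child_def)
  note ne = adjD(3)[OF simpleT ab(1)]
  have out: "pt a b s \<in> realization T - realization S" if "0 < s" "s \<le> 1" for s
  proof -
    have "q b = 0" if "q \<in> realization S" for q
    proof -
      from that consider u where "u \<in> verts S" "q = vpt u" | e where "e \<in> edges S" "q \<in> closed_edge e"
        by (auto simp: realization_def)
      then show ?thesis
        using ab(2) simpleS by cases (auto simp: vpt_def closed_edge_def simple_graph_def)
    qed
    moreover have "pt a b s b = s" using ne by (simp add: pt_def vpt_def)
    ultimately show ?thesis using that pt_realization[OF simpleT ab(1), of s] by force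
  qed
  show ?thesis
  proof
    fix p assume p: "p \<in> closed_edge {a, b}"
    obtain s where s: "p = pt a b s" "0 \<le> s" "s \<le> 1" using closed_edge_pt[OF ne p] by blast
    show "p \<in> gtop T closure_of (realization T - realization S)"
      unfolding gtop_def M.metric_closure_of
    proof (intro CollectI conjI allI impI)
      show pT: "p \<in> realization T" using s pt_realization[OF simpleT ab(1)] by simp
      fix r :: real assume r: "r > 0"
      \<comment> \<open>Only the end \<open>s = 0\<close> has to be moved into the open
        complement.\<close>
      define t where "t = (if s > 0 then s else min (r / 2) 1)"
      have t: "0 < t" "t \<le> 1" "\<bar>s - t\<bar> < r" using s r by (auto simp: t_def)
      have "gdist T p (pt a b t) < r"
        using gdist_pt_le[OF connT ab(1), of s t] s t by simp
      then have "pt a b t \<in> M.mball p r" using pT out[OF t(1,2)] by (simp add: M.in_mball)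
      then show "\<exists>y\<in>realization T - realization S. y \<in> M.mball p r" using out[OF t(1,2)] by blast
    qed
  qed
qed

text \<open>The edges of a nontrivial block lie in the closed complement and connect the block to
  \<open>w\<close>, so the block is inside one component. A trivial block need not meet the closed
  complement; there \<open>C \<ge> 1\<close> suffices.\<close>

lemma block_le_if_complemented:
  assumes C: "C_complemented C T S" and C1: "C \<ge> 1" and w: "w \<in> verts S"
  shows "finite (block T v S w) \<and> card (block T v S w) \<le> C"
proof (cases "block T v S w = {w}")
  case False
  let ?cl = "gtop T closure_of (realization T - realization S)"
  let ?X = "subtopology (gtop T) ?cl"
  have edge: "connected_component_of ?X (vpt a) (vpt b)" if ab: "off T v S a b" for a b
  proof -
    have adj: "adj T a b" using ab by (auto simp: off_def child_def)
    have "connectedin (gtop T) (pt a b ` {0..1})"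
      by (rule connectedin_continuous_map_image[OF continuous_pt[OF connT adj]])
        (simp add: connectedin_subtopology)
    moreover have "pt a b ` {0..1} \<subseteq> ?cl"
      using off_edge_closed[OF ab] pt_in_closed_edge[OF adjD(3)[OF simpleT adj]] by force
    ultimately have "connectedin ?X (pt a b ` {0..1})" by (simp add: connectedin_subtopology)
    moreover have "vpt a \<in> pt a b ` {0..1}" "vpt b \<in> pt a b ` {0..1}"
      using image_eqI[of "vpt a" "pt a b" 0] image_eqI[of "vpt b" "pt a b" 1] by auto
    ultimately show ?thesis unfolding connected_component_of_def by blast
  qed
  obtain x where x: "x \<in> block T v S w" "x \<noteq> w" using False by (auto simp: block_def)
  then obtain c where "off T v S w c" by (auto simp: block_def elim: converse_rtranclpE)
  then have wX: "connected_component_of ?X (vpt w) (vpt w)"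
    using edge connected_component_of_refl connected_component_of_equiv by metis
  have "connected_component_of ?X (vpt w) (vpt x)" if "(off T v S)\<^sup>*\<^sup>* w x" for x
    using that
  proof (induction rule: rtranclp_induct)
    case (step y z)
    then show ?case using edge[OF step.hyps(2)] connected_component_of_trans by metis
  qed (rule wX)
  then have sub': "block T v S w \<subseteq> {u \<in> verts T. vpt u \<in> connected_component_of_set ?X (vpt w)}"
    using off_reach_vert[OF _ sub_vert[OF w]] by (auto simp: block_def)
  have "connected_component_of_set ?X (vpt w) \<in> connected_components_of ?X"
    using wX by (auto simp: connected_components_of_def connected_component_of_refl)
  then have "finite {u \<in> verts T. vpt u \<in> connected_component_of_set ?X (vpt w)}"
    "card {u \<in> verts T. vpt u \<in> connected_component_of_set ?X (vpt w)} \<le> C"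
    using C unfolding C_complemented_def by auto
  then show ?thesis using finite_subset[OF sub'] card_mono[OF _ sub'] by simp
qed (use C1 in simp)

text \<open>The function that is 0 on the block of \<open>w\<close>, 1 on all other vertices and affine on edges
  takes only these two values on the closed complement of \<open>S\<close>.\<close>

lemma complemented_if_block_le:
  assumes C: "\<And>w. w \<in> verts S \<Longrightarrow> finite (block T v S w) \<and> card (block T v S w) \<le> C"
  shows "C_complemented C T S"
  unfolding C_complemented_def
proof (intro ballI)
  let ?U = "realization T - realization S"
  let ?X = "subtopology (gtop T) (gtop T closure_of ?U)"
  fix T0 assume T0: "T0 \<in> connected_components_of ?X"
  show "finite {u \<in> verts T. vpt u \<in> T0} \<and> card {u \<in> verts T. vpt u \<in> T0} \<le> C"
  proof (cases "{u \<in> verts T. vpt u \<in> T0} = {}")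
    case False
    then obtain u where u: "u \<in> verts T" "vpt u \<in> T0" by blast
    define w where "w = ret T v S u"
    have w: "w \<in> verts S" using ret(1)[OF u(1)] by (simp add: w_def)
    define \<psi> :: "'a \<Rightarrow> real" where "\<psi> x = (if ret T v S x = w then 0 else 1)" for x
    have cont: "continuous_map (gtop T) euclideanreal (lin \<psi>)"
      by (rule continuous_lin[OF connT]) (simp add: \<psi>_def)
    have top: "topspace (gtop T) = realization T"
      using Metric_space.topspace_mtopology[OF Metric_space_gdist[OF connT]] by (simp add: gtop_def)
    have "lin \<psi> p \<in> {0, 1}" if p: "p \<in> ?U" for p
    proof -
      from p have "p \<in> realization T" by simp
      with simpleT show ?thesis
      proof (cases rule: realization_cases)
        case (vertex a)
        then show ?thesis by (simp add: \<psi>_def)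
      next
        case (edge a b s)
        \<comment> \<open>An interior point outside \<open>S\<close> lies on an edge outside
          \<open>S\<close>, whose ends belong to the same block; so \<open>\<psi>\<close> takes the
          same value at both ends.\<close>
        have "\<not> adj S a b" using pt_realization[OF simpleS, of a b s] edge p by auto
        then have "\<psi> a = \<psi> b" using adj_ret[OF edge(1)] by (simp add: \<psi>_def)
        then have "lin \<psi> p = \<psi> a"
          using edge lin_pt[OF adjD(3)[OF simpleT edge(1)], of \<psi> s] by (simp add: algebra_simps)
        then show ?thesis by (simp add: \<psi>_def)
      qed
    qed
    then have "?U \<subseteq> {p \<in> topspace (gtop T). lin \<psi> p \<in> {0, 1}}" using top by auto
    moreover have "closedin (gtop T) {p \<in> topspace (gtop T). lin \<psi> p \<in> {0, 1}}"
      by (rule closedin_continuous_map_preimage[OF cont]) (simp add: closed_insert flip: closed_closedin)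
    ultimately have cl: "gtop T closure_of ?U \<subseteq> {p \<in> topspace (gtop T). lin \<psi> p \<in> {0, 1}}"
      by (rule closure_of_minimal)
    have con: "connectedin ?X T0" by (rule connectedin_connected_components_of[OF T0])
    then have T0': "connectedin (gtop T) T0" "T0 \<subseteq> gtop T closure_of ?U"
      by (auto simp: connectedin_subtopology)
    \<comment> \<open>A connected set of reals containing 0 and 1 would contain
      \<open>1 / 2\<close>, which is not a value on the closed complement.\<close>
    have "connected (lin \<psi> ` T0)"
      using connectedin_continuous_map_image[OF cont T0'(1)] by simp
    moreover have "lin \<psi> (vpt u) = 0" by (simp add: \<psi>_def w_def)
    then have "0 \<in> lin \<psi> ` T0" using u(2) by (metis imageI)
    moreover have "1 / 2 \<notin> lin \<psi> ` T0" using T0'(2) cl by fastforce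
    ultimately have "1 \<notin> lin \<psi> ` T0"
      using connected_contains_Icc[of "lin \<psi> ` T0" 0 1] by (auto simp: subset_eq)
    have "ret T v S x = w" if "vpt x \<in> T0" for x
      using \<open>1 \<notin> lin \<psi> ` T0\<close> imageI[OF that, of "lin \<psi>"] by (simp add: \<psi>_def split: if_splits)
    then have "{x \<in> verts T. vpt x \<in> T0} \<subseteq> block T v S w"
      using block_eq[OF w] by auto
    then show ?thesis
      using C[OF w] by (meson card_mono finite_subset le_trans)
  next
    case True
    show ?thesis unfolding True by simp
  qed
qed

end

section \<open>Trees with positive Cheeger constant\<close>

definition desc :: "'a ugraph \<Rightarrow> 'a \<Rightarrow> 'a \<Rightarrow> 'a set" where
  "desc G v x = {y. (child G v)\<^sup>*\<^sup>* x y}"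

context
  fixes T :: "'a ugraph" and v :: 'a
  assumes T: "rooted_tree T v"
begin

lemma desc_vert: "x \<in> verts T \<Longrightarrow> desc T v x \<subseteq> verts T"
proof
  fix y assume x: "x \<in> verts T" and "y \<in> desc T v x"
  then have "(child T v)\<^sup>*\<^sup>* x y" by (simp add: desc_def)
  then show "y \<in> verts T"
    by (induction rule: rtranclp_induct) (use x childD[OF root_connected[OF T]] in auto)
qed

lemma desc_unfold: "desc T v x = insert x (\<Union>c\<in>{c. child T v x c}. desc T v c)"
  by (auto simp: desc_def intro: converse_rtranclp_into_rtranclp elim: converse_rtranclpE)

lemma child_desc: "y \<in> desc T v x \<Longrightarrow> child T v y z \<Longrightarrow> z \<in> desc T v x"
  unfolding desc_def by (simp add: rtranclp.rtrancl_into_rtrancl)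

text \<open>Whole branches can only be left upwards, and by uniqueness of parents only from some
  \<open>c\<close> to \<open>x\<close>.\<close>

lemma bd_desc_children:
  assumes F: "\<And>c. c \<in> F \<Longrightarrow> child T v x c"
  shows "bd T (\<Union>c\<in>F. desc T v c) \<subseteq> {x}"
proof
  fix y assume "y \<in> bd T (\<Union>c\<in>F. desc T v c)"
  then obtain a c where c: "c \<in> F" "a \<in> desc T v c" "adj T a y"
    and y: "\<And>c. c \<in> F \<Longrightarrow> y \<notin> desc T v c" by (auto simp: bd_def)
  note uniq = parent_unique[OF root_tree[OF T] root_vert[OF T]]
  show "y \<in> {x}"
  proof (rule child_cases[OF root_tree[OF T] root_vert[OF T] c(3)])
    assume "child T v a y"
    then show ?thesis using child_desc[OF c(2)] y[OF c(1)] by blast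
  next
    assume ya: "child T v y a"
    have "(child T v)\<^sup>*\<^sup>* c a" using c(2) by (simp add: desc_def)
    then show ?thesis
    proof (cases rule: rtranclp.cases)
      case rtrancl_refl
      then show ?thesis using uniq[OF ya] F[OF c(1)] by simp
    next
      case (rtrancl_into_rtrancl b)
      then have "y \<in> desc T v c" using uniq[OF ya] by (simp add: desc_def)
      then show ?thesis using y c(1) by blast
    qed
  qed
qed

lemma cheeger_desc_children:
  assumes F: "finite F" "\<And>c. c \<in> F \<Longrightarrow> child T v x c" "\<And>c. c \<in> F \<Longrightarrow> finite (desc T v c)"
    and X: "X \<subseteq> (\<Union>c\<in>F. desc T v c)"
  shows "cheeger T * of_nat (card X) \<le> 1"
proof -
  let ?U = "\<Union>c\<in>F. desc T v c"
  have fU: "finite ?U" using F by blast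
  have UT: "?U \<subseteq> verts T" using desc_vert childD(2)[OF root_connected[OF T] F(2)] by blast
  have "cheeger T * of_nat (card X) \<le> cheeger T * of_nat (card ?U)"
    using card_mono[OF fU X] by (intro mult_left_mono) auto
  also have "\<dots> \<le> ecard (bd T ?U)" by (rule cheeger_mult_card_le[OF root_connected[OF T] fU UT])
  also have "\<dots> \<le> of_nat 1"
    by (rule ecard_le[of "{x}"]) (use bd_desc_children[of F x] F(2) in auto)
  finally show ?thesis by simp
qed

text \<open>The step of Koenig's lemma, with positivity of the Cheeger constant in place of local
  finiteness.\<close>

lemma infinite_desc_child:
  assumes h: "0 < cheeger T" and inf: "infinite (desc T v x)"
  shows "\<exists>c. child T v x c \<and> infinite (desc T v c)"
proof (rule ccontr)
  assume "\<nexists>c. child T v x c \<and> infinite (desc T v c)"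
  then have fin: "finite (desc T v c)" if "child T v x c" for c using that by blast
  have "infinite {c. child T v x c}"
  proof
    assume "finite {c. child T v x c}"
    then have "finite (desc T v x)" using fin by (subst desc_unfold) auto
    then show False using inf by simp
  qed
  moreover obtain N :: nat where N: "0 < N" "of_nat 1 < cheeger T * of_nat N"
    using ennreal_archimedean[OF h] .
  ultimately obtain F where F: "F \<subseteq> {c. child T v x c}" "card F = N" "finite F"
    using infinite_arbitrarily_large by blast
  have "F \<subseteq> (\<Union>c\<in>F. desc T v c)" by (auto simp: desc_def)
  then have "cheeger T * of_nat N \<le> 1"
    using cheeger_desc_children[of F x F] F fin by auto
  then show False using N(2) by simp
qed

end

lemma connected_if_reachable:
  assumes "simple_graph G" "\<And>x. x \<in> verts G \<Longrightarrow> (adj G)\<^sup>*\<^sup>* v x"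
  shows "connected_graph G"
proof -
  have "symp (adj G)\<^sup>*\<^sup>*" by (rule symp_rtranclp) (auto intro: sympI simp: adj_sym)
  then show ?thesis using assms unfolding connected_graph_def by (meson rtranclp_trans sympD)
qed

lemma tree_subgraph:
  assumes "tree T" "subgraph_of S T" "connected_graph S"
  shows "tree S"
proof -
  have "is_cycle T us" if "is_cycle S us" for us
    using that assms(2) unfolding is_cycle_def
    by (auto simp: subgraph_of_def adj_def elim!: successively_mono)
  then show ?thesis using assms by (auto simp: tree_def)
qed

section \<open>Positivity and the maximal geodesically complete subtree\<close>

context
  fixes T S :: "'a ugraph" and v :: 'a
  assumes T: "rooted_tree T v" and M: "maximal_geodesically_complete_subtree T v S"
begin

lemma max_rooted: "rooted_tree S v" and max_sub: "subgraph_of S T"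
  and max_gc: "geodesically_complete S v"
  using M by (auto simp: maximal_geodesically_complete_subtree_def geodesically_complete_subtree_def)

text \<open>Adding the ray to \<open>S\<close> gives a subtree in which every vertex has a child,
  hence a geodesically complete one, and maximality absorbs it.\<close>

lemma ray_in_maximal:
  assumes R: "R 0 = v" "\<And>i. child T v (R i) (R (Suc i))"
  shows "R n \<in> verts S"
proof -
  note cT = root_connected[OF T]
  define S' :: "'a ugraph" where
    "S' = \<lparr>verts = verts S \<union> range R, edges = edges S \<union> range (\<lambda>i. {R i, R (Suc i)})\<rparr>"
  have v': "verts S' = verts S \<union> range R" and e': "edges S' = edges S \<union> range (\<lambda>i. {R i, R (Suc i)})"
    by (simp_all add: S'_def)
  have RD: "R i \<in> verts T" "adj T (R i) (R (Suc i))" for i using childD[OF cT R(2)] by auto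
  have subT: "subgraph_of S' T"
    using max_sub RD by (auto simp: subgraph_of_def v' e' adj_def)
  have SS': "subgraph_of S S'" by (auto simp: subgraph_of_def v' e')
  have vS: "v \<in> verts S" using root_vert[OF max_rooted] .
  have aS': "adj S' (R i) (R (Suc i))" for i by (auto simp: adj_def e')
  have simple: "simple_graph S'"
    unfolding simple_graph_def
  proof
    fix e assume e: "e \<in> edges S'"
    then have "card e = 2"
      using subT root_simple[OF T] by (auto simp: simple_graph_def subgraph_of_def)
    moreover have "e \<subseteq> verts S'"
      using e root_simple[OF max_rooted] by (auto simp: v' e' simple_graph_def)
    ultimately show "e \<subseteq> verts S' \<and> card e = 2" by simp
  qed
  have "(adj S')\<^sup>*\<^sup>* v (R i)" for i
    by (induction i) (use R(1) aS' in \<open>auto intro: rtranclp.rtrancl_into_rtrancl\<close>)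
  moreover have "(adj S')\<^sup>*\<^sup>* v x" if "x \<in> verts S" for x
  proof -
    have "(adj S)\<^sup>*\<^sup>* v x"
      using root_connected[OF max_rooted] vS that by (simp add: connected_graph_def)
    then show ?thesis by (rule rtranclp_mono[THEN predicate2D, rotated]) (auto simp: adj_def e')
  qed
  ultimately have "connected_graph S'"
    by (intro connected_if_reachable[OF simple, of v]) (auto simp: v')
  then have rS': "rooted_tree S' v"
    using tree_subgraph[OF root_tree[OF T] subT] vS by (simp add: rooted_tree_def v')
  have "\<exists>y. child S' v x y" if x: "x \<in> verts S'" for x
  proof (cases "x \<in> range R")
    case True
    then obtain i where "x = R i" by blast
    then show ?thesis using child_sub[OF T rS' subT, of x "R (Suc i)"] R(2)[of i] by (auto simp: v')
  next
    case False
    \<comment> \<open>The root is on the ray, so the vertex \<open>x\<close> is not the exceptional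
      one for geodesic completeness.\<close>
    then have "x \<in> verts S" "x \<noteq> v" using x R(1) by (auto simp: v')
    then obtain y where "child S v x y"
      using child_if_geodesically_complete[OF max_rooted max_gc] by blast
    then have "child T v x y" "y \<in> verts S" using child_sub[OF T max_rooted max_sub] by auto
    then show ?thesis using child_sub[OF T rS' subT, of x y] by (auto simp: v')
  qed
  then have "geodesically_complete S' v" by (rule geodesically_complete_if_children[OF rS'])
  then have "S' = S"
    using M SS' subT rS' by (simp add: maximal_geodesically_complete_subtree_def geodesically_complete_subtree_def)
  then show ?thesis using v' by auto
qed

text \<open>The path from the root to \<open>x\<close>, continued through children with infinitely
  many descendants, is a ray.\<close>

lemma infinite_desc_in_maximal:
  assumes h: "0 < cheeger T" and x: "x \<in> verts T" and inf: "infinite (desc T v x)"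
  shows "x \<in> verts S"
proof -
  define N where "N = hop T v x"
  obtain R0 where R0: "geoseq T v R0 N" "R0 N = x" using geoseq_exists[OF T x] unfolding N_def .
  have "\<exists>c. infinite (desc T v y) \<longrightarrow> child T v y c \<and> infinite (desc T v c)" for y
    using infinite_desc_child[OF T h, of y] by metis
  then obtain c where c: "\<And>y. infinite (desc T v y) \<Longrightarrow> child T v y (c y) \<and> infinite (desc T v (c y))"
    by metis
  have ci: "infinite (desc T v ((c ^^ k) x))" for k by (induction k) (use inf c in auto)
  define R where "R i = (if i \<le> N then R0 i else (c ^^ (i - N)) x)" for i
  have "child T v (R i) (R (Suc i))" for i
  proof -
    consider "Suc i \<le> N" | "i = N" | "N < i" by linarith
    then show ?thesis
    proof cases
      case 1
      then show ?thesis using R0 by (simp add: R_def geoseq_def)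
    next
      case 2
      then show ?thesis using c[OF inf] R0(2) by (simp add: R_def)
    next
      case 3
      then show ?thesis using c[OF ci[of "i - N"]] by (simp add: R_def Suc_diff_le)
    qed
  qed
  moreover have "R 0 = v" using R0(1) by (simp add: R_def geoseq_def)
  ultimately have "R N \<in> verts S" using ray_in_maximal by blast
  then show ?thesis using R0(2) by (simp add: R_def)
qed

text \<open>Branches leaving \<open>S\<close> are finite. Finitely many vertices of a block below
  \<open>w\<close> lie in finitely many branches, whose union has at most the boundary point
  \<open>w\<close>; so there are fewer than \<open>N\<close> of them, even if infinitely many
  branches might start at \<open>w\<close>.\<close>

lemma block_le_if_cheeger_pos:
  assumes h: "0 < cheeger T"
  obtains C where "\<And>w. w \<in> verts S \<Longrightarrow> finite (block T v S w) \<and> card (block T v S w) \<le> C"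
proof -
  obtain N :: nat where N: "0 < N" "of_nat 1 < cheeger T * of_nat N" using ennreal_archimedean[OF h] .
  have "finite (block T v S w) \<and> card (block T v S w) \<le> N" if w: "w \<in> verts S" for w
  proof -
    let ?O = "{c. off T v S w c}"
    have sub: "block T v S w - {w} \<subseteq> (\<Union>c\<in>?O. desc T v c)"
    proof
      fix x assume x: "x \<in> block T v S w - {w}"
      then have "(off T v S)\<^sup>*\<^sup>* w x" "x \<noteq> w" by (auto simp: block_def)
      then obtain c where c: "off T v S w c" "(off T v S)\<^sup>*\<^sup>* c x" by (auto elim: converse_rtranclpE)
      have "(child T v)\<^sup>*\<^sup>* c x"
        by (rule rtranclp_mono[THEN predicate2D, OF _ c(2)]) (auto simp: off_def)
      then show "x \<in> (\<Union>c\<in>?O. desc T v c)" using c(1) by (auto simp: desc_def)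
    qed
    have fd: "finite (desc T v c)" if "c \<in> ?O" for c
      using infinite_desc_in_maximal[OF h, of c] that childD(2)[OF root_connected[OF T], of v w c]
      by (auto simp: off_def)
    have small: "card X < N" if X: "finite X" "X \<subseteq> block T v S w - {w}" for X
    proof -
      have "\<forall>x\<in>X. \<exists>c. c \<in> ?O \<and> x \<in> desc T v c" using X sub by blast
      then obtain g where g: "\<And>x. x \<in> X \<Longrightarrow> g x \<in> ?O \<and> x \<in> desc T v (g x)" by metis
      have "cheeger T * of_nat (card X) \<le> 1"
        by (rule cheeger_desc_children[OF T, of "g ` X" w]) (use X g fd in \<open>auto simp: off_def\<close>)
      then have "cheeger T * of_nat (card X) < cheeger T * of_nat N" using N(2) by auto
      then show ?thesis by (meson mult_left_mono not_le of_nat_mono zero_le)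
    qed
    have fin: "finite (block T v S w - {w})"
    proof (rule ccontr)
      assume "infinite (block T v S w - {w})"
      then obtain X where "X \<subseteq> block T v S w - {w}" "card X = N" "finite X"
        using infinite_arbitrarily_large by blast
      then show False using small[of X] by simp
    qed
    \<comment> \<open>Fewer than \<open>N\<close> vertices below \<open>w\<close>, together with
      \<open>w\<close> itself, give the bound \<open>N\<close>.\<close>
    have "card (block T v S w) \<le> Suc (card (block T v S w - {w}))"
      using fin by (metis card_Suc_Diff1 Diff_empty Diff_insert0 finite_Diff_insert le_SucI order_refl finite.emptyI Diff_idemp)
    then show ?thesis using small[OF fin] fin by simp
  qed
  then show thesis by (rule that)
qed

lemma cheeger_pos_imp:
  assumes h: "0 < cheeger T"
  shows "pseudo_regular S v \<and> complemented T S"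
proof -
  obtain C where C: "\<And>w. w \<in> verts S \<Longrightarrow> finite (block T v S w) \<and> card (block T v S w) \<le> C"
    using block_le_if_cheeger_pos[OF h] by blast
  have "complemented T S"
    using complemented_if_block_le[OF T max_rooted max_sub C] by (auto simp: complemented_def)
  have hS: "0 < cheeger S"
    using h cheeger_le_sub[OF T max_rooted max_sub] C by (meson less_le_trans)
  note cS = root_connected[OF max_rooted] and vS = root_vert[OF max_rooted]
  \<comment> \<open>Geodesic completeness does not provide a child of the root. A childless root
    would have empty boundary in \<open>S\<close>, against positivity.\<close>
  have "\<exists>y. child S v v y"
  proof (rule ccontr)
    assume no: "\<nexists>y. child S v v y"
    have "bd S {v} = {}"
    proof (rule ccontr)
      assume "bd S {v} \<noteq> {}"
      then obtain y where y: "adj S v y" by (auto simp: bd_def)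
      show False
        by (rule child_cases[OF root_tree[OF max_rooted] vS y]) (use no childD(4)[OF cS, of v _ v] in auto)
    qed
    then have "cheeger S * of_nat (card {v}) \<le> 0"
      using cheeger_mult_card_le[OF cS, of "{v}"] vS by (simp add: ecard_def)
    then show False using hS by simp
  qed
  then have ch: "\<exists>y. child S v x y" if "x \<in> verts S" for x
    using child_if_geodesically_complete[OF max_rooted max_gc that] by (cases "x = v") auto
  have "pseudo_regular S v" by (rule pseudo_regular_if_cheeger_pos[OF max_rooted ch hS])
  then show ?thesis using \<open>complemented T S\<close> by simp
qed

lemma cheeger_bounds:
  assumes K: "K \<ge> 1" and C: "C \<ge> 1" and pr: "K_pseudo_regular K S v" and co: "C_complemented C T S"
  shows "cheeger T \<le> cheeger S" "cheeger_lower C (cheeger S) \<le> cheeger T"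
    "1 / of_nat ((7 * K + 1) * C - 1) \<le> cheeger_lower C (cheeger S)"
proof -
  note B = block_le_if_complemented[OF T max_rooted max_sub co C]
  show "cheeger T \<le> cheeger S" using cheeger_le_sub[OF T max_rooted max_sub] B by blast
  show "cheeger_lower C (cheeger S) \<le> cheeger T" by (rule cheeger_lower_le[OF T max_rooted max_sub B C])
  note cS = root_connected[OF max_rooted]
  have pr': "\<exists>p q. p \<noteq> q \<and> (child S v ^^ K) a p \<and> (child S v ^^ K) a q" if "a \<in> verts S" for a
    using pr that unfolding K_pseudo_regular_iff[OF max_rooted] by simp
  have K0: "real K > 0" using K by simp
  have h: "ennreal (1 / (2 * K)) \<le> cheeger S"
    unfolding le_cheeger_iff[OF cS]
  proof (intro allI impI)
    fix A assume A: "A \<noteq> {} \<and> finite A \<and> A \<subseteq> verts S"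
    show "ennreal (1 / (2 * K)) * of_nat (card A) \<le> ecard (bd S A)"
    proof (cases "finite (bd S A)")
      case True
      have "card A \<le> 2 * K * card (bd S A)"
        by (rule pseudo_regular_isoperimetry[OF max_rooted _ _ K pr' True]) (use A in auto)
      then have "real (card A) \<le> 2 * K * card (bd S A)" by (metis of_nat_le_iff)
      then have "1 / (2 * K) * card A \<le> card (bd S A)" using K0 by (simp add: field_simps)
      then show ?thesis using True K0
        by (simp add: ecard_def ennreal_of_nat_eq_real_of_nat ennreal_mult[symmetric] ennreal_leI)
    qed (simp add: ecard_def)
  qed
  define n where "n = (7 * K + 1) * C - 1"
  have "(7 * K + 1) * C = 7 * K * C + C" by simp
  \<comment> \<open>For finite \<open>h = cheeger S\<close>, the claim
    \<open>1 / n \<le> h / (C + (C - 1) * h)\<close> amounts to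
    \<open>C \<le> 7 * K * C * h\<close>, which follows from
    \<open>1 \<le> 2 * K * h\<close>.\<close>
  then have n: "n = 7 * K * C + (C - 1)" using C by (simp add: n_def)
  have "0 < 7 * K * C" using K C by simp
  then have n0: "n > 0" unfolding n by (rule trans_less_add1)
  show "1 / of_nat ((7 * K + 1) * C - 1) \<le> cheeger_lower C (cheeger S)"
    unfolding n_def[symmetric]
  proof (cases "cheeger S = \<infinity>")
    case True
    \<comment> \<open>For \<open>C = 1\<close> the right side is \<open>1 / 0\<close>, which is
      infinite.\<close>
    have "1 / of_nat n \<le> (1 / of_nat (C - 1) :: ennreal)"
    proof (cases "C - 1 = 0")
      case False
      then show ?thesis
        using n by (simp add: ennreal_of_nat_eq_real_of_nat divide_ennreal frac_le ennreal_leI flip: ennreal_1 del: of_nat_diff)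
    qed simp
    then show "1 / of_nat n \<le> cheeger_lower C (cheeger S)" using True by (simp add: cheeger_lower_def)
  next
    case False
    then obtain r where r: "cheeger S = ennreal r" "0 \<le> r" by (cases "cheeger S") auto
    have "1 / (2 * real K) \<le> r" using h r by (simp add: ennreal_le_iff)
    then have Kr: "1 \<le> 2 * K * r" using K0 by (simp add: field_simps)
    have "real C * 1 \<le> real C * (2 * K * r)" by (rule mult_left_mono[OF Kr]) simp
    also have "\<dots> \<le> 7 * K * C * r" using r(2) by simp
    finally have 1: "real C + real (C - 1) * r \<le> n * r" by (simp add: n algebra_simps del: of_nat_diff)
    define d where "d = real C + real (C - 1) * r"
    have d: "d > 0" using C r by (simp add: d_def add_pos_nonneg)
    have "1 / real n \<le> r / d" using 1[folded d_def] d n0 by (simp add: field_simps)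
    moreover have "cheeger_lower C (cheeger S) = ennreal (r / d)"
      using cheeger_lower_ennreal[OF C r(2)] r(1) by (simp add: d_def)
    moreover have "1 / of_nat n = ennreal (1 / real n)"
      using n0 by (simp add: ennreal_of_nat_eq_real_of_nat divide_ennreal flip: ennreal_1)
    ultimately show "1 / of_nat n \<le> cheeger_lower C (cheeger S)" by (simp add: ennreal_leI)
  qed
qed

lemma cheeger_pos_if:
  assumes "pseudo_regular S v" "complemented T S"
  shows "0 < cheeger T"
proof -
  obtain K where K: "K_pseudo_regular K S v" using assms by (auto simp: pseudo_regular_def)
  obtain C where C: "C_complemented C T S" using assms by (auto simp: complemented_def)
  \<comment> \<open>At depth 0 the only descendant of a vertex is itself, so there are no two
    distinct ones.\<close>
  have "K \<noteq> 0"
  proof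
    assume "K = 0"
    then show False
      using K root_vert[OF max_rooted] unfolding K_pseudo_regular_iff[OF max_rooted] by auto
  qed
  then have K1: "K \<ge> 1" by simp
  \<comment> \<open>The bounds require \<open>C \<ge> 1\<close>, and the complementedness condition
    is monotone in \<open>C\<close>.\<close>
  have C': "C_complemented (Suc C) T S" using C by (auto simp: C_complemented_def intro: le_SucI)
  have "0 < (1 :: ennreal) / of_nat ((7 * K + 1) * Suc C - 1)"
    by (simp only: ennreal_zero_less_divide of_nat_less_top) simp
  also have "\<dots> \<le> cheeger_lower (Suc C) (cheeger S)" by (rule cheeger_bounds(3)[OF K1 _ K C']) simp
  also have "\<dots> \<le> cheeger T" by (rule cheeger_bounds(2)[OF K1 _ K C']) simp
  finally show ?thesis .
qed

end

theorem theorem3p16: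
  fixes T Tinf :: "'a ugraph" and v :: 'a
  assumes "rooted_tree T v"
    and "diam T = \<infinity>"
    and "maximal_geodesically_complete_subtree T v Tinf"
  shows "(0 < cheeger T \<longleftrightarrow> pseudo_regular Tinf v \<and> complemented T Tinf) \<and>
    (\<forall>K\<ge>1. \<forall>C\<ge>1. K_pseudo_regular K Tinf v \<and> C_complemented C T Tinf \<longrightarrow>
       cheeger Tinf \<ge> cheeger T \<and>
       cheeger T \<ge> cheeger_lower C (cheeger Tinf) \<and>
       cheeger_lower C (cheeger Tinf) \<ge> 1 / of_nat ((7 * K + 1) * C - 1))"
proof (intro conjI allI impI)
  show "0 < cheeger T \<longleftrightarrow> pseudo_regular Tinf v \<and> complemented T Tinf"
    using cheeger_pos_imp[OF assms(1,3)] cheeger_pos_if[OF assms(1,3)] by blast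
qed (use cheeger_bounds[OF assms(1,3)] in blast)+

end
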